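(* Let $\Bbbk$ be a field, $G$ a finite group, and $R=(u,r,p,v)$ a quasitriangular structure of $\mathcal D(G)$. Then the Drinfel'd element of the quasitriangular Hopf algebra $(\mathcal D(G),R)$ is $$u_R=\sum_{a,s\in G} r(s)e_{s^{-1}}\bowtie p(e_a)\,a^{-1}\,v(s)\,u^*(s).$$ Furthermore, $u_R$ is also a ribbon element of $(\mathcal D(G),R)$.
   Context: Double. $\Bbbk^G$ is the algebra of functions $G\to\Bbbk$ with basis $e_g$ ($e_g(h)=\delta_{g,h}$) and unit $1=\varepsilon=\sum_g e_g$; $\Bbbk^{G\,\mathrm{co}}$ is the Hopf algebra $\Bbbk^G$ with opposite coproduct, $\Delta(e_x)=\sum_{s\in G}e_s\otimes e_{xs^{-1}}$. $G$ acts by conjugation: $g\rightharpoonup e_x=e_{gxg^{-1}}$. $\mathcal D(G)$ is $\Bbbk^{G\,\mathrm{co}}\otimes\Bbbk G$ as a coalgebra, with elements $f\bowtie g$ and product $(f\bowtie g)(f'\bowtie g')=f(g\rightharpoonup f')\bowtie gg'$. Quasitriangular structures. For a Hopf algebra $H$ with flip $\tau$, a quasitriangular structure is $R\in H\otimes H$ with $(\Delta\otimes\mathrm{id})(R)=R^{13}R^{23}$, $(\mathrm{id}\otimes\Delta)(R)=R^{13}R^{12}$, $(\varepsilon\otimes\mathrm{id})(R)=1=(\mathrm{id}\otimes\varepsilon)(R)$ (such $R$ is invertible) and $R\Delta(h)=\tau(\Delta(h))R$ for all $h\in H$. The Drinfel'd element is $u_R=m(\tau(R^{-1}))$, with $m$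 the multiplication. A ribbon element of $(H,R)$ is a central invertible $\nu\in H$ with $\nu^2=u_R\,S(u_R)$, $\varepsilon(\nu)=1$, $S(\nu)=\nu$ and $\tau(R)R\,\Delta(\nu)=\nu\otimes\nu$. Components. Let $f\# g\in\mathcal D(G)^*$ be the functional $e_s\bowtie h\mapsto\delta_{s,g}f(h)$, and for $R\in\mathcal D(G)\otimes\mathcal D(G)$ let $F(R)(\phi)=(\phi\otimes\mathrm{id})(R)$. Write $R=(u,r,p,v)$, where, with $(\mathrm{id}\otimes\varepsilon)(f\bowtie g)=f$ and $(\mathrm{ev}_1\otimes\mathrm{id})(f\bowtie g)=f(1)g$: $u(f)=(\mathrm{id}\otimes\varepsilon)F(R)(f\#1)$, $r(g)=(\mathrm{id}\otimes\varepsilon)F(R)(\varepsilon\# g)$, $p(f)=(\mathrm{ev}_1\otimes\mathrm{id})F(R)(f\#1)$, $v(g)=(\mathrm{ev}_1\otimes\mathrm{id})F(R)(\varepsilon\# g)$. Thus $u:\Bbbk^G\to\Bbbk^G$, $r:\Bbbk G\to\Bbbk^G$, $p:\Bbbk^G\to\Bbbk G$, $v:\Bbbk G\to\Bbbk G$ are linear maps, and $u^*:\Bbbk G\to\Bbbk G$ is the transpose of $u$. In the formula for $u_R$, the product $p(e_a)a^{-1}v(s)u^*(s)$ is taken in $\Bbbk G$. *)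

theory Defs
  imports "HOL-Library.Function_Algebras"
begin

section \<open>Linear algebra on finite-dimensional spaces with a chosen basis\<close>

text \<open>A space with basis \<open>'b\<close> is the space of coefficient functions \<open>'b \<Rightarrow> 'k\<close>. The tensor product of
  the spaces over \<open>'b\<close> and \<open>'c\<close> is the space over \<open>'b \<times> 'c\<close>.  The arithmetic on functions is the
  pointwise one of the library.\<close>

definition delta :: "'b \<Rightarrow> 'b \<Rightarrow> 'k::field" where
  "delta b = (\<lambda>x. if x = b then 1 else 0)"

definition scale :: "'k::field \<Rightarrow> ('b \<Rightarrow> 'k) \<Rightarrow> 'b \<Rightarrow> 'k" where
  "scale c x = (\<lambda>b. c * x b)"

definition tensor :: "('b \<Rightarrow> 'k::field) \<Rightarrow> ('c \<Rightarrow> 'k) \<Rightarrow> 'b \<times> 'c \<Rightarrow> 'k" where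
  "tensor x y = (\<lambda>(b, c). x b * y c)"

text \<open>The linear (bilinear) map with prescribed values on the basis.\<close>

definition lin_ext :: "('b::finite \<Rightarrow> 'c \<Rightarrow> 'k::field) \<Rightarrow> ('b \<Rightarrow> 'k) \<Rightarrow> 'c \<Rightarrow> 'k" where
  "lin_ext \<phi> x = (\<Sum>b\<in>UNIV. scale (x b) (\<phi> b))"

definition bilin_ext ::
  "('a::finite \<Rightarrow> 'b::finite \<Rightarrow> 'c \<Rightarrow> 'k::field) \<Rightarrow> ('a \<Rightarrow> 'k) \<Rightarrow> ('b \<Rightarrow> 'k) \<Rightarrow> 'c \<Rightarrow> 'k" where
  "bilin_ext \<phi> x y = (\<Sum>a\<in>UNIV. \<Sum>b\<in>UNIV. scale (x a * y b) (\<phi> a b))"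

text \<open>For linear maps \<open>f\<close> and \<open>g\<close>, the map \<open>f \<otimes> g\<close>; for a linear functional \<open>\<phi>\<close>, the maps
  \<open>\<phi> \<otimes> id\<close> and \<open>id \<otimes> \<phi>\<close>, with \<open>k \<otimes> V\<close> and \<open>V \<otimes> k\<close> identified with \<open>V\<close>.\<close>

definition tensor_map ::
  "(('a::finite \<Rightarrow> 'k::field) \<Rightarrow> 'c \<Rightarrow> 'k) \<Rightarrow> (('b::finite \<Rightarrow> 'k) \<Rightarrow> 'd \<Rightarrow> 'k) \<Rightarrow>
   ('a \<times> 'b \<Rightarrow> 'k) \<Rightarrow> 'c \<times> 'd \<Rightarrow> 'k" where
  "tensor_map f g = lin_ext (\<lambda>(a, b). tensor (f (delta a)) (g (delta b)))"

definition contract_left ::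
  "(('a::finite \<Rightarrow> 'k::field) \<Rightarrow> 'k) \<Rightarrow> ('a \<times> 'b::finite \<Rightarrow> 'k) \<Rightarrow> 'b \<Rightarrow> 'k" where
  "contract_left \<phi> = lin_ext (\<lambda>(a, b). scale (\<phi> (delta a)) (delta b))"

definition contract_right ::
  "(('b::finite \<Rightarrow> 'k::field) \<Rightarrow> 'k) \<Rightarrow> ('a::finite \<times> 'b \<Rightarrow> 'k) \<Rightarrow> 'a \<Rightarrow> 'k" where
  "contract_right \<phi> = lin_ext (\<lambda>(a, b). scale (\<phi> (delta b)) (delta a))"

definition flip :: "('a \<times> 'b \<Rightarrow> 'k) \<Rightarrow> 'b \<times> 'a \<Rightarrow> 'k" where
  "flip t = (\<lambda>(b, a). t (a, b))"

definition reassoc :: "(('a \<times> 'b) \<times> 'c \<Rightarrow> 'k) \<Rightarrow> 'a \<times> 'b \<times> 'c \<Rightarrow> 'k" where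
  "reassoc t = (\<lambda>(a, b, c). t ((a, b), c))"

text \<open>For a linear map \<open>f : k\<^sup>G \<rightarrow> k\<^sup>G\<close>, the map \<open>f\<^sup>* : kG \<rightarrow> kG\<close> that is adjoint to \<open>f\<close> for the
  evaluation pairing of \<open>kG\<close> with \<open>k\<^sup>G\<close>.\<close>

definition transpose_map ::
  "(('a::finite \<Rightarrow> 'k::field) \<Rightarrow> 'b::finite \<Rightarrow> 'k) \<Rightarrow> ('b \<Rightarrow> 'k) \<Rightarrow> 'a \<Rightarrow> 'k" where
  "transpose_map f x = (\<lambda>a. \<Sum>b\<in>UNIV. x b * f (delta a) b)"

definition linear_map :: "(('a \<Rightarrow> 'k::field) \<Rightarrow> 'b \<Rightarrow> 'k) \<Rightarrow> bool" where
  "linear_map f \<longleftrightarrow> (\<forall>x y. f (x + y) = f x + f y) \<and> (\<forall>c x. f (scale c x) = scale c (f x))"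

definition linear_functional :: "(('a \<Rightarrow> 'k::field) \<Rightarrow> 'k) \<Rightarrow> bool" where
  "linear_functional f \<longleftrightarrow> (\<forall>x y. f (x + y) = f x + f y) \<and> (\<forall>c x. f (scale c x) = c * f x)"


section \<open>Hopf algebras, quasitriangular structures and ribbon elements\<close>

record ('b, 'k) hopf_data =
  hmult :: "('b \<Rightarrow> 'k) \<Rightarrow> ('b \<Rightarrow> 'k) \<Rightarrow> 'b \<Rightarrow> 'k"
  hone :: "'b \<Rightarrow> 'k"
  hcomult :: "('b \<Rightarrow> 'k) \<Rightarrow> 'b \<times> 'b \<Rightarrow> 'k"
  hcounit :: "('b \<Rightarrow> 'k) \<Rightarrow> 'k"
  hantipode :: "('b \<Rightarrow> 'k) \<Rightarrow> 'b \<Rightarrow> 'k"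

text \<open>Product of the tensor product of two algebras, \<open>(a \<otimes> b)(c \<otimes> d) = ac \<otimes> bd\<close>.\<close>

definition tensor_mult ::
  "(('a::finite \<Rightarrow> 'k::field) \<Rightarrow> ('a \<Rightarrow> 'k) \<Rightarrow> 'a \<Rightarrow> 'k) \<Rightarrow>
   (('b::finite \<Rightarrow> 'k) \<Rightarrow> ('b \<Rightarrow> 'k) \<Rightarrow> 'b \<Rightarrow> 'k) \<Rightarrow>
   ('a \<times> 'b \<Rightarrow> 'k) \<Rightarrow> ('a \<times> 'b \<Rightarrow> 'k) \<Rightarrow> 'a \<times> 'b \<Rightarrow> 'k" where
  "tensor_mult m n =
     bilin_ext (\<lambda>(a, b) (c, d). tensor (m (delta a) (delta c)) (n (delta b) (delta d)))"

definition mult2 :: "('b::finite, 'k::field) hopf_data \<Rightarrow>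
    ('b \<times> 'b \<Rightarrow> 'k) \<Rightarrow> ('b \<times> 'b \<Rightarrow> 'k) \<Rightarrow> 'b \<times> 'b \<Rightarrow> 'k" where
  "mult2 H = tensor_mult (hmult H) (hmult H)"

definition mult3 :: "('b::finite, 'k::field) hopf_data \<Rightarrow>
    ('b \<times> 'b \<times> 'b \<Rightarrow> 'k) \<Rightarrow> ('b \<times> 'b \<times> 'b \<Rightarrow> 'k) \<Rightarrow> 'b \<times> 'b \<times> 'b \<Rightarrow> 'k" where
  "mult3 H = tensor_mult (hmult H) (mult2 H)"

definition one2 :: "('b, 'k::field) hopf_data \<Rightarrow> 'b \<times> 'b \<Rightarrow> 'k" where
  "one2 H = tensor (hone H) (hone H)"

text \<open>The multiplication as a linear map on the tensor square.\<close>

definition mult_map :: "('b::finite, 'k::field) hopf_data \<Rightarrow> ('b \<times> 'b \<Rightarrow> 'k) \<Rightarrow> 'b \<Rightarrow> 'k" where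
  "mult_map H = lin_ext (\<lambda>(a, b). hmult H (delta a) (delta b))"

definition hopf_algebra :: "('b::finite, 'k::field) hopf_data \<Rightarrow> bool" where
  "hopf_algebra H \<longleftrightarrow>
     (\<forall>x. linear_map (hmult H x)) \<and> (\<forall>y. linear_map (\<lambda>x. hmult H x y)) \<and>
     linear_map (hcomult H) \<and> linear_functional (hcounit H) \<and> linear_map (hantipode H) \<and>
     (\<forall>x y z. hmult H (hmult H x y) z = hmult H x (hmult H y z)) \<and>
     (\<forall>x. hmult H (hone H) x = x \<and> hmult H x (hone H) = x) \<and>
     (\<forall>x. reassoc (tensor_map (hcomult H) id (hcomult H x)) =
            tensor_map id (hcomult H) (hcomult H x)) \<and>
     (\<forall>x. contract_left (hcounit H) (hcomult H x) = x \<and>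
            contract_right (hcounit H) (hcomult H x) = x) \<and>
     (\<forall>x y. hcomult H (hmult H x y) = mult2 H (hcomult H x) (hcomult H y)) \<and>
     hcomult H (hone H) = one2 H \<and>
     (\<forall>x y. hcounit H (hmult H x y) = hcounit H x * hcounit H y) \<and> hcounit H (hone H) = 1 \<and>
     (\<forall>x. mult_map H (tensor_map (hantipode H) id (hcomult H x)) = scale (hcounit H x) (hone H) \<and>
            mult_map H (tensor_map id (hantipode H) (hcomult H x)) = scale (hcounit H x) (hone H))"

definition leg12 :: "('b, 'k::field) hopf_data \<Rightarrow> ('b \<times> 'b \<Rightarrow> 'k) \<Rightarrow> 'b \<times> 'b \<times> 'b \<Rightarrow> 'k" where
  "leg12 H R = (\<lambda>(a, b, c). R (a, b) * hone H c)"

definition leg13 :: "('b, 'k::field) hopf_data \<Rightarrow> ('b \<times> 'b \<Rightarrow> 'k) \<Rightarrow> 'b \<times> 'b \<times> 'b \<Rightarrow> 'k" where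
  "leg13 H R = (\<lambda>(a, b, c). R (a, c) * hone H b)"

definition leg23 :: "('b, 'k::field) hopf_data \<Rightarrow> ('b \<times> 'b \<Rightarrow> 'k) \<Rightarrow> 'b \<times> 'b \<times> 'b \<Rightarrow> 'k" where
  "leg23 H R = (\<lambda>(a, b, c). R (b, c) * hone H a)"

definition quasitriangular ::
  "('b::finite, 'k::field) hopf_data \<Rightarrow> ('b \<times> 'b \<Rightarrow> 'k) \<Rightarrow> bool" where
  "quasitriangular H R \<longleftrightarrow>
     reassoc (tensor_map (hcomult H) id R) = mult3 H (leg13 H R) (leg23 H R) \<and>
     tensor_map id (hcomult H) R = mult3 H (leg13 H R) (leg12 H R) \<and>
     contract_left (hcounit H) R = hone H \<and>
     contract_right (hcounit H) R = hone H \<and>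
     (\<forall>h. mult2 H R (hcomult H h) = mult2 H (flip (hcomult H h)) R)"

text \<open>The two-sided inverse in \<open>H \<otimes> H\<close>; unspecified where there is none.\<close>

definition inverse2 :: "('b::finite, 'k::field) hopf_data \<Rightarrow> ('b \<times> 'b \<Rightarrow> 'k) \<Rightarrow> 'b \<times> 'b \<Rightarrow> 'k" where
  "inverse2 H R = (THE Q. mult2 H R Q = one2 H \<and> mult2 H Q R = one2 H)"

definition drinfeld_element ::
  "('b::finite, 'k::field) hopf_data \<Rightarrow> ('b \<times> 'b \<Rightarrow> 'k) \<Rightarrow> 'b \<Rightarrow> 'k" where
  "drinfeld_element H R = mult_map H (flip (inverse2 H R))"

definition ribbon_element ::
  "('b::finite, 'k::field) hopf_data \<Rightarrow> ('b \<times> 'b \<Rightarrow> 'k) \<Rightarrow> ('b \<Rightarrow> 'k) \<Rightarrow> bool" where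
  "ribbon_element H R \<nu> \<longleftrightarrow>
     (\<forall>h. hmult H \<nu> h = hmult H h \<nu>) \<and>
     (\<exists>\<mu>. hmult H \<nu> \<mu> = hone H \<and> hmult H \<mu> \<nu> = hone H) \<and>
     hmult H \<nu> \<nu> = hmult H (drinfeld_element H R) (hantipode H (drinfeld_element H R)) \<and>
     hcounit H \<nu> = 1 \<and>
     hantipode H \<nu> = \<nu> \<and>
     mult2 H (mult2 H (flip R) R) (hcomult H \<nu>) = tensor \<nu> \<nu>"


section \<open>The double of a finite group\<close>

text \<open>The group is a finite type of class \<^class>\<open>group_add\<close>, the library's class of possibly
  non-commutative groups. It is written additively: \<open>gh\<close>, \<open>g\<^sup>-\<^sup>1\<close> and \<open>1\<close> become \<open>g + h\<close>, \<open>- g\<close>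
  and \<open>0\<close>.

  Both \<open>k\<^sup>G\<close> and \<open>kG\<close> are the space \<open>'g \<Rightarrow> 'k\<close>: \<open>delta x\<close> is \<open>e\<^sub>x\<close> in the former and the group
  element \<open>x\<close> in the latter. The product \<open>*\<close> and the unit \<open>1\<close> of functions are those of \<open>k\<^sup>G\<close>.\<close>

definition grp_mult ::
  "('g::{finite,group_add} \<Rightarrow> 'k::field) \<Rightarrow> ('g \<Rightarrow> 'k) \<Rightarrow> 'g \<Rightarrow> 'k" (infixl \<open>\<cdot>\<close> 70) where
  "grp_mult = bilin_ext (\<lambda>g h. delta (g + h))"

text \<open>The conjugation action, on basis elements \<open>g \<rightharpoonup> e\<^sub>x = e\<^bsub>gxg\<^sup>-\<^sup>1\<^esub>\<close>.\<close>

definition conj_act :: "'g::{finite,group_add} \<Rightarrow> ('g \<Rightarrow> 'k::field) \<Rightarrow> 'g \<Rightarrow> 'k" where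
  "conj_act g = lin_ext (\<lambda>x. delta (g + x - g))"

definition bowtie :: "('g \<Rightarrow> 'k::field) \<Rightarrow> ('g \<Rightarrow> 'k) \<Rightarrow> 'g \<times> 'g \<Rightarrow> 'k" (infix \<open>\<bowtie>\<close> 60) where
  "f \<bowtie> x = tensor f x"

text \<open>The antipode comes from \<open>S(f \<bowtie> g) = (1 \<bowtie> g\<^sup>-\<^sup>1)(S(f) \<bowtie> 1)\<close>.\<close>

definition group_double :: "('g::{finite,group_add} \<times> 'g, 'k::field) hopf_data" where
  "group_double = \<lparr>
     hmult = bilin_ext (\<lambda>(x, g) (y, h). delta x * conj_act g (delta y) \<bowtie> delta (g + h)),
     hone = 1 \<bowtie> delta 0,
     hcomult = lin_ext (\<lambda>(x, g). \<Sum>s\<in>UNIV. tensor (delta s \<bowtie> delta g) (delta (x - s) \<bowtie> delta g)),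
     hcounit = (\<lambda>X. \<Sum>(x, g)\<in>UNIV. X (x, g) * (if x = 0 then 1 else 0)),
     hantipode = lin_ext (\<lambda>(x, g). delta (- g - x + g) \<bowtie> delta (- g)) \<rparr>"


subsection \<open>The components of an element of the tensor square\<close>

text \<open>The functional \<open>f # g\<close>, which maps \<open>e\<^sub>s \<bowtie> h\<close> to \<open>\<delta>\<^bsub>s,g\<^esub> f(h)\<close>.\<close>

definition dual_elem ::
  "('g::finite \<Rightarrow> 'k::field) \<Rightarrow> 'g \<Rightarrow> ('g \<times> 'g \<Rightarrow> 'k) \<Rightarrow> 'k" where
  "dual_elem f g X = (\<Sum>(s, h)\<in>UNIV. X (s, h) * (if s = g then f h else 0))"

definition Fmap :: "('b::finite \<times> 'b \<Rightarrow> 'k::field) \<Rightarrow> (('b \<Rightarrow> 'k) \<Rightarrow> 'k) \<Rightarrow> 'b \<Rightarrow> 'k" where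
  "Fmap R \<phi> = contract_left \<phi> R"

text \<open>The projections \<open>f \<bowtie> g \<mapsto> f\<close> and \<open>f \<bowtie> g \<mapsto> f(1) g\<close> for \<open>g \<in> G\<close>.\<close>

definition proj_fun :: "('g::finite \<times> 'g \<Rightarrow> 'k::field) \<Rightarrow> 'g \<Rightarrow> 'k" where
  "proj_fun = contract_right (\<lambda>x. \<Sum>h\<in>UNIV. x h)"

definition proj_grp :: "('g::{finite,group_add} \<times> 'g \<Rightarrow> 'k::field) \<Rightarrow> 'g \<Rightarrow> 'k" where
  "proj_grp = contract_left (\<lambda>f. f 0)"

type_synonym ('g, 'k) double2 = "('g \<times> 'g) \<times> ('g \<times> 'g) \<Rightarrow> 'k"

definition comp_u :: "('g::{finite,group_add}, 'k::field) double2 \<Rightarrow> ('g \<Rightarrow> 'k) \<Rightarrow> 'g \<Rightarrow> 'k" where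
  "comp_u R f = proj_fun (Fmap R (dual_elem f 0))"

definition comp_r :: "('g::{finite,group_add}, 'k::field) double2 \<Rightarrow> ('g \<Rightarrow> 'k) \<Rightarrow> 'g \<Rightarrow> 'k" where
  "comp_r R = lin_ext (\<lambda>g. proj_fun (Fmap R (dual_elem 1 g)))"

definition comp_p :: "('g::{finite,group_add}, 'k::field) double2 \<Rightarrow> ('g \<Rightarrow> 'k) \<Rightarrow> 'g \<Rightarrow> 'k" where
  "comp_p R f = proj_grp (Fmap R (dual_elem f 0))"

definition comp_v :: "('g::{finite,group_add}, 'k::field) double2 \<Rightarrow> ('g \<Rightarrow> 'k) \<Rightarrow> 'g \<Rightarrow> 'k" where
  "comp_v R = lin_ext (\<lambda>g. proj_grp (Fmap R (dual_elem 1 g)))"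

subsection \<open>The double is a Hopf algebra\<close>

lemma sum_fun_apply: "(\<Sum>a\<in>A. f a) x = (\<Sum>a\<in>A. f a x)"
  by (induction A rule: infinite_finite_induct) auto

lemma sum_UNIV_prod: "(\<Sum>p\<in>UNIV. f p) = (\<Sum>a\<in>UNIV. \<Sum>b\<in>UNIV. f (a, b))"
  for f :: "'a::finite \<times> 'b::finite \<Rightarrow> 'c::comm_monoid_add"
  by (simp add: sum.cartesian_product flip: UNIV_Times_UNIV)

lemma sum_pick:
  "(\<Sum>x\<in>UNIV. \<Sum>g\<in>UNIV. if x = a then f x g else 0) = (\<Sum>g\<in>UNIV. f a g)"
  for a :: "'a::finite" and f :: "'a \<Rightarrow> 'b::finite \<Rightarrow> 'c::comm_monoid_add"
  by (subst sum.swap) simp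

lemma lin_ext_apply: "lin_ext \<phi> x c = (\<Sum>b\<in>UNIV. x b * \<phi> b c)"
  by (simp add: lin_ext_def sum_fun_apply scale_def)

lemma bilin_ext_apply: "bilin_ext \<phi> x y c = (\<Sum>a\<in>UNIV. \<Sum>b\<in>UNIV. x a * y b * \<phi> a b c)"
  by (simp add: bilin_ext_def sum_fun_apply scale_def)

lemma linear_map_lin_ext: "linear_map (lin_ext \<phi>)"
  by (auto simp: linear_map_def fun_eq_iff lin_ext_apply scale_def sum.distrib algebra_simps
      sum_distrib_left)

lemma linear_map_bilin_ext:
  "linear_map (bilin_ext \<phi> x)" "linear_map (\<lambda>x. bilin_ext \<phi> x y)"
  by (auto simp: linear_map_def fun_eq_iff bilin_ext_apply scale_def sum.distrib algebra_simps
      sum_distrib_left)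

lemma group_eq_simps:
  fixes a b c :: "'g::group_add"
  shows "b = a + c \<longleftrightarrow> c = - a + b" "b = a + c - a \<longleftrightarrow> c = - a + b + a"
    "b = c - a \<longleftrightarrow> c = b + a" "b = - a - c + a \<longleftrightarrow> c = a - b - a" "b = - a \<longleftrightarrow> a = - b"
proof -
  show "b = a + c \<longleftrightarrow> c = - a + b"
    by (metis add.assoc add_minus_cancel minus_add_cancel)
  show "b = a + c - a \<longleftrightarrow> c = - a + b + a"
    by (metis add.assoc add_diff_cancel diff_add_cancel minus_add_cancel add_minus_cancel)
  show "b = c - a \<longleftrightarrow> c = b + a"
    by (metis add_diff_cancel diff_add_cancel)
  show "b = - a - c + a \<longleftrightarrow> c = a - b - a"
    by (metis (no_types, opaque_lifting) add.assoc add_diff_cancel diff_add_cancel minus_add_cancel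
        add_minus_cancel diff_diff_eq2 diff_conv_add_uminus minus_add minus_minus)
  show "b = - a \<longleftrightarrow> a = - b" by auto
qed

lemma delta_apply: "delta b x = (if x = b then 1 else 0)"
  by (simp add: delta_def)

lemma delta_translate:
  fixes g h k s x :: "'g::group_add"
  shows delta_mult: "delta (g + k) h = (if k = - g + h then 1 else 0)"
    and delta_conj: "delta (g + x - g) s = (if x = - g + s + g then 1 else 0)"
    and delta_diff: "delta (x - g) s = (if x = s + g then 1 else 0)"
    and delta_antipode: "delta (- g - x + g) s = (if x = g - s - g then 1 else 0)"
    and delta_uminus: "delta (- g) s = (if g = - s then 1 else 0)"
  unfolding delta_apply by (rule if_cong[OF _ refl refl], rule group_eq_simps)+

lemma conj_act_apply: "conj_act g f x = f (- g + x + g)"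
  by (simp add: conj_act_def lin_ext_apply delta_conj if_distrib cong: if_cong)

lemma conj_act_delta: "conj_act g (delta y) x = (if y = - g + x + g then 1 else 0)"
  by (simp only: conj_act_apply delta_apply eq_commute)

lemma double_mult_apply:
  "hmult group_double X Y (s, h) = (\<Sum>g\<in>UNIV. X (s, g) * Y (- g + s + g, - g + h))"
proof -
  have "hmult group_double X Y (s, h) =
     (\<Sum>x\<in>UNIV. \<Sum>g\<in>UNIV. \<Sum>y\<in>UNIV. \<Sum>k\<in>UNIV.
        if k = - g + h then if y = - g + s + g then if x = s then X (x, g) * Y (y, k) else 0 else 0 else 0)"
    unfolding group_double_def hopf_data.simps bilin_ext_apply sum_UNIV_prod prod.case bowtie_def
      tensor_def times_fun_apply conj_act_delta delta_mult delta_apply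
    by (intro sum.cong refl) simp
  also have "\<dots> = (\<Sum>x\<in>UNIV. \<Sum>g\<in>UNIV. if x = s then X (x, g) * Y (- g + s + g, - g + h) else 0)"
    by simp
  also have "\<dots> = (\<Sum>g\<in>UNIV. X (s, g) * Y (- g + s + g, - g + h))"
    by (rule sum_pick)
  finally show ?thesis .
qed

lemma double_mult_delta:
  "hmult group_double (delta (x, g)) (delta (y, k)) (s, h) =
     (if x = s \<and> y = - g + s + g \<and> k = - g + h then 1 else 0)"
proof -
  have "hmult group_double (delta (x, g)) (delta (y, k)) (s, h) =
      (\<Sum>g'\<in>UNIV. if g' = g then (if x = s \<and> y = - g + s + g \<and> k = - g + h then 1 else 0) else 0)"
    unfolding double_mult_apply by (intro sum.cong refl) (simp add: delta_def)
  then show ?thesis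
    by simp
qed

lemma double_comult_apply:
  "hcomult group_double X ((s, g), (t, h)) = (if g = h then X (t + s, g) else 0)"
proof -
  have "hcomult group_double X ((s, g), (t, h)) =
     (\<Sum>x\<in>UNIV. \<Sum>k\<in>UNIV. \<Sum>r\<in>UNIV.
        if r = s then if x = t + r then if k = g then if g = h then X (x, k) else 0 else 0 else 0 else 0)"
    unfolding group_double_def hopf_data.simps lin_ext_apply sum_UNIV_prod prod.case sum_fun_apply
      bowtie_def tensor_def delta_diff delta_apply sum_distrib_left
    by (intro sum.cong refl) simp
  also have "\<dots> = (\<Sum>x\<in>UNIV. \<Sum>k\<in>UNIV.
        if x = t + s then if k = g then if g = h then X (x, k) else 0 else 0 else 0)"
    by simp
  also have "\<dots> = (if g = h then X (t + s, g) else 0)"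
    by (subst sum_pick) simp
  finally show ?thesis .
qed

lemma double_counit_apply: "hcounit group_double X = (\<Sum>g\<in>UNIV. X (0, g))"
proof -
  have "hcounit group_double X = (\<Sum>x\<in>UNIV. \<Sum>g\<in>UNIV. if x = 0 then X (x, g) else 0)"
    by (auto simp: group_double_def sum_UNIV_prod intro!: sum.cong)
  then show ?thesis
    by (subst (asm) sum.swap) simp
qed

lemma double_antipode_apply: "hantipode group_double X (s, h) = X (- h - s + h, - h)"
proof -
  have "hantipode group_double X (s, h) =
     (\<Sum>x\<in>UNIV. \<Sum>g\<in>UNIV. if g = - h then if x = g - s - g then X (x, g) else 0 else 0)"
    unfolding group_double_def hopf_data.simps lin_ext_apply sum_UNIV_prod prod.case
      bowtie_def tensor_def delta_antipode delta_uminus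
    by (intro sum.cong refl) simp
  then show ?thesis
    by simp
qed

lemma double_one_apply: "hone group_double (s, h) = (if h = 0 then 1 else 0)"
  by (simp add: group_double_def bowtie_def tensor_def delta_def)

lemma tensor_map_apply:
  "tensor_map f g t (c, d) = (\<Sum>a\<in>UNIV. \<Sum>b\<in>UNIV. t (a, b) * (f (delta a) c * g (delta b) d))"
  by (simp add: tensor_map_def lin_ext_apply sum_UNIV_prod tensor_def)

lemma linear_map_sum:
  assumes "linear_map f" "finite A"
  shows "f (\<Sum>a\<in>A. scale (x a) (y a)) = (\<Sum>a\<in>A. scale (x a) (f (y a)))"
proof -
  have "f 0 = 0"
    using assms(1) unfolding linear_map_def by (metis add_cancel_right_left)
  with assms(2,1) show ?thesis
    by (induction A) (auto simp: linear_map_def)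
qed

lemma linear_map_expand:
  fixes x :: "'a::finite \<Rightarrow> 'k::field"
  assumes "linear_map f"
  shows "(\<Sum>a\<in>UNIV. x a * f (delta a) c) = f x c"
proof -
  have "x = (\<Sum>a\<in>UNIV. scale (x a) (delta a))"
    by (simp add: fun_eq_iff sum_fun_apply scale_def delta_apply if_distrib cong: if_cong)
  then have "f x c = f (\<Sum>a\<in>UNIV. scale (x a) (delta a)) c"
    by simp
  also have "\<dots> = (\<Sum>a\<in>UNIV. scale (x a) (f (delta a))) c"
    by (simp only: linear_map_sum[OF assms finite])
  finally show ?thesis
    by (simp add: sum_fun_apply scale_def)
qed

lemma tensor_map_id_right:
  assumes "linear_map f"
  shows "tensor_map f id t (c, d) = f (\<lambda>a. t (a, d)) c"
proof -
  have "tensor_map f id t (c, d) =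
      (\<Sum>a\<in>UNIV. \<Sum>b\<in>UNIV. if b = d then t (a, d) * f (delta a) c else 0)"
    unfolding tensor_map_apply by (intro sum.cong refl) (simp add: delta_apply)
  then show ?thesis
    using linear_map_expand[OF assms, of "\<lambda>a. t (a, d)"] by simp
qed

lemma tensor_map_id_left:
  assumes "linear_map g"
  shows "tensor_map id g t (c, d) = g (\<lambda>b. t (c, b)) d"
proof -
  have "tensor_map id g t (c, d) =
      (\<Sum>a\<in>UNIV. \<Sum>b\<in>UNIV. if a = c then t (c, b) * g (delta b) d else 0)"
    unfolding tensor_map_apply by (intro sum.cong refl) (simp add: delta_apply)
  then show ?thesis
    using linear_map_expand[OF assms, of "\<lambda>b. t (c, b)"] by (subst (asm) sum.swap) simp
qed

lemma double_counit_delta: "hcounit group_double (delta (x, g)) = (if x = 0 then 1 else 0)"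
  by (auto simp: double_counit_apply delta_def)

lemma double_contract_left:
  "contract_left (hcounit group_double) T (s, h) = (\<Sum>g\<in>UNIV. T ((0, g), (s, h)))"
proof -
  have "contract_left (hcounit group_double) T (s, h) =
     (\<Sum>x\<in>UNIV. \<Sum>g\<in>UNIV. \<Sum>y\<in>UNIV. \<Sum>k\<in>UNIV.
        if k = h then if y = s then if x = 0 then T ((x, g), (y, k)) else 0 else 0 else 0)"
    unfolding contract_left_def lin_ext_apply sum_UNIV_prod prod.case double_counit_delta scale_def
    by (intro sum.cong refl) (simp add: delta_apply)
  also have "\<dots> = (\<Sum>x\<in>UNIV. \<Sum>g\<in>UNIV. if x = 0 then T ((x, g), (s, h)) else 0)"
    by simp
  also have "\<dots> = (\<Sum>g\<in>UNIV. T ((0, g), (s, h)))"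
    by (rule sum_pick)
  finally show ?thesis .
qed

lemma double_contract_right:
  "contract_right (hcounit group_double) T (s, h) = (\<Sum>g\<in>UNIV. T ((s, h), (0, g)))"
proof -
  have "contract_right (hcounit group_double) T (s, h) =
     (\<Sum>y\<in>UNIV. \<Sum>k\<in>UNIV. \<Sum>x\<in>UNIV. \<Sum>g\<in>UNIV.
        if x = 0 then if y = s then if k = h then T ((y, k), (x, g)) else 0 else 0 else 0)"
    unfolding contract_right_def lin_ext_apply sum_UNIV_prod prod.case double_counit_delta scale_def
    by (intro sum.cong refl) (simp add: delta_apply)
  also have "\<dots> = (\<Sum>y\<in>UNIV. \<Sum>k\<in>UNIV. if y = s then
        if k = h then \<Sum>g\<in>UNIV. T ((y, k), (0, g)) else 0 else 0)"
    by (intro sum.cong refl, subst sum_pick) simp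
  also have "\<dots> = (\<Sum>g\<in>UNIV. T ((s, h), (0, g)))"
    by (subst sum_pick) simp
  finally show ?thesis .
qed

lemma double_mult_map:
  "mult_map group_double T (s, h) = (\<Sum>g\<in>UNIV. T ((s, g), (- g + s + g, - g + h)))"
proof -
  have "mult_map group_double T (s, h) =
     (\<Sum>x\<in>UNIV. \<Sum>g\<in>UNIV. \<Sum>y\<in>UNIV. \<Sum>k\<in>UNIV.
        if k = - g + h then if y = - g + s + g then if x = s then T ((x, g), (y, k)) else 0 else 0 else 0)"
    unfolding mult_map_def lin_ext_apply sum_UNIV_prod prod.case double_mult_delta
    by (intro sum.cong refl) simp
  also have "\<dots> = (\<Sum>x\<in>UNIV. \<Sum>g\<in>UNIV. if x = s then T ((x, g), (- g + s + g, - g + h)) else 0)"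
    by simp
  also have "\<dots> = (\<Sum>g\<in>UNIV. T ((s, g), (- g + s + g, - g + h)))"
    by (rule sum_pick)
  finally show ?thesis .
qed

lemma double_mult2:
  "mult2 group_double X Y ((s, h), (t, k)) =
     (\<Sum>g\<in>UNIV. \<Sum>l\<in>UNIV. X ((s, g), (t, l)) * Y ((- g + s + g, - g + h), (- l + t + l, - l + k)))"
    (is "_ = ?r")
proof -
  have "mult2 group_double X Y ((s, h), (t, k)) =
     (\<Sum>x\<in>UNIV. \<Sum>g\<in>UNIV. \<Sum>y\<in>UNIV. \<Sum>l\<in>UNIV.
       \<Sum>x'\<in>UNIV. \<Sum>g'\<in>UNIV. \<Sum>y'\<in>UNIV. \<Sum>l'\<in>UNIV.
        if l' = - l + k then if y' = - l + t + l then if g' = - g + h then if x' = - g + s + g then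
          if y = t then if x = s then X ((x, g), (y, l)) * Y ((x', g'), (y', l'))
          else 0 else 0 else 0 else 0 else 0 else 0)"
    unfolding mult2_def tensor_mult_def tensor_def bilin_ext_apply sum_UNIV_prod prod.case
      double_mult_delta
    by (intro sum.cong refl) simp
  also have "\<dots> = (\<Sum>x\<in>UNIV. \<Sum>g\<in>UNIV. \<Sum>y\<in>UNIV. \<Sum>l\<in>UNIV. if y = t then if x = s then
        X ((x, g), (y, l)) * Y ((- g + s + g, - g + h), (- l + t + l, - l + k)) else 0 else 0)"
    by simp
  also have "\<dots> = (\<Sum>x\<in>UNIV. \<Sum>g\<in>UNIV. if x = s then
      \<Sum>l\<in>UNIV. X ((x, g), (t, l)) * Y ((- g + s + g, - g + h), (- l + t + l, - l + k)) else 0)"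
    by (intro sum.cong refl, subst sum_pick) simp
  also have "\<dots> = ?r"
    by (rule sum_pick)
  finally show ?thesis .
qed

lemma sum_shift:
  "(\<Sum>g\<in>UNIV. f g) = (\<Sum>g\<in>UNIV. f (l + g))"
  for f :: "'g::{finite,group_add} \<Rightarrow> 'k::comm_monoid_add" and l :: 'g
  by (rule sum.reindex_bij_witness[of _ "\<lambda>g. l + g" "\<lambda>g. - l + g"]) (auto simp: add.assoc[symmetric])

theorem hopf_algebra_group_double:
  "hopf_algebra (group_double :: ('g::{finite,group_add} \<times> 'g, 'k::field) hopf_data)"
    (is "hopf_algebra ?H")
proof -
  have lin: "linear_map (hmult ?H x)" "linear_map (\<lambda>x. hmult ?H x y)" "linear_map (hcomult ?H)"
    "linear_map (hantipode ?H)" for x y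
    by (simp_all add: group_double_def linear_map_lin_ext linear_map_bilin_ext)
  have eps: "linear_functional (hcounit ?H)"
    by (simp add: linear_functional_def double_counit_apply sum.distrib scale_def sum_distrib_left)
  have assoc: "hmult ?H (hmult ?H x y) z = hmult ?H x (hmult ?H y z)" for x y z
  proof -
    have "hmult ?H (hmult ?H x y) z (s, h) = hmult ?H x (hmult ?H y z) (s, h)" for s h
    proof -
      have "hmult ?H (hmult ?H x y) z (s, h) =
          (\<Sum>l\<in>UNIV. \<Sum>g\<in>UNIV. x (s, l) * y (- l + s + l, - l + g) * z (- g + s + g, - g + h))"
        unfolding double_mult_apply sum_distrib_right by (rule sum.swap)
      also have "\<dots> = (\<Sum>l\<in>UNIV. \<Sum>g\<in>UNIV. x (s, l) *
          (y (- l + s + l, g) * z (- g + (- l + s + l) + g, - g + (- l + h))))"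
      proof (rule sum.cong[OF refl])
        show "(\<Sum>g\<in>UNIV. x (s, l) * y (- l + s + l, - l + g) * z (- g + s + g, - g + h)) =
          (\<Sum>g\<in>UNIV. x (s, l) *
             (y (- l + s + l, g) * z (- g + (- l + s + l) + g, - g + (- l + h))))" for l
          by (subst sum_shift[of _ l])
             (simp add: minus_add add.assoc mult.assoc diff_conv_add_uminus del: add_uminus_conv_diff)
      qed
      finally show ?thesis
        by (simp add: double_mult_apply sum_distrib_left)
    qed
    then show ?thesis
      by (auto simp: fun_eq_iff)
  qed
  have unit: "hmult ?H (hone ?H) x = x" "hmult ?H x (hone ?H) = x" for x
  proof -
    have "hmult ?H (hone ?H) x (s, h) = (\<Sum>g::'g\<in>UNIV. if g = 0 then x (s, h) else 0)" for s h
      unfolding double_mult_apply double_one_apply by (intro sum.cong refl) simp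
    moreover have "hmult ?H x (hone ?H) (s, h) = (\<Sum>g\<in>UNIV. if g = h then x (s, h) else 0)" for s h
      unfolding double_mult_apply double_one_apply
      by (intro sum.cong refl) (auto simp flip: eq_neg_iff_add_eq_0)
    ultimately show "hmult ?H (hone ?H) x = x" "hmult ?H x (hone ?H) = x"
      by (auto simp: fun_eq_iff)
  qed
  have coassoc: "reassoc (tensor_map (hcomult ?H) id (hcomult ?H x)) =
      tensor_map id (hcomult ?H) (hcomult ?H x)" for x
    by (auto simp: fun_eq_iff reassoc_def tensor_map_id_right[OF lin(3)]
        tensor_map_id_left[OF lin(3)] double_comult_apply add.assoc)
  have counit: "contract_left (hcounit ?H) (hcomult ?H x) = x"
    "contract_right (hcounit ?H) (hcomult ?H x) = x" for x
    by (auto simp: fun_eq_iff double_contract_left double_contract_right double_comult_apply)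
  have comult_mult: "hcomult ?H (hmult ?H x y) = mult2 ?H (hcomult ?H x) (hcomult ?H y)" for x y
  proof -
    have "mult2 ?H (hcomult ?H x) (hcomult ?H y) ((s, h), (t, k)) =
        hcomult ?H (hmult ?H x y) ((s, h), (t, k))" for s h t k
    proof -
      have "mult2 ?H (hcomult ?H x) (hcomult ?H y) ((s, h), (t, k)) =
        (\<Sum>g\<in>UNIV. \<Sum>l\<in>UNIV. if l = g then
           if h = k then x (t + s, g) * y (- g + (t + s) + g, - g + h) else 0 else 0)"
        unfolding double_mult2 double_comult_apply
        by (intro sum.cong refl) (auto simp: add.assoc)
      then show ?thesis
        by (simp add: double_comult_apply double_mult_apply)
    qed
    then show ?thesis
      by (auto simp: fun_eq_iff)
  qed
  have comult_one: "hcomult ?H (hone ?H) = one2 ?H"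
    by (auto simp: fun_eq_iff double_comult_apply one2_def tensor_def double_one_apply)
  have counit_mult: "hcounit ?H (hmult ?H x y) = hcounit ?H x * hcounit ?H y" for x y
  proof -
    have "hcounit ?H (hmult ?H x y) = (\<Sum>g\<in>UNIV. \<Sum>h\<in>UNIV. x (0, g) * y (0, - g + h))"
      unfolding double_counit_apply double_mult_apply by (subst sum.swap) simp
    also have "\<dots> = (\<Sum>g\<in>UNIV. \<Sum>h\<in>UNIV. x (0, g) * y (0, h))"
    proof (rule sum.cong[OF refl])
      show "(\<Sum>h\<in>UNIV. x (0, g) * y (0, - g + h)) = (\<Sum>h\<in>UNIV. x (0, g) * y (0, h))" for g
        by (rule sum_shift[of _ "- g", symmetric])
    qed
    finally show ?thesis
      by (simp add: double_counit_apply sum_product)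
  qed
  have counit_one: "hcounit ?H (hone ?H) = 1"
    by (simp add: double_counit_apply double_one_apply)
  have antipode: "mult_map ?H (tensor_map (hantipode ?H) id (hcomult ?H x)) =
        scale (hcounit ?H x) (hone ?H)"
      "mult_map ?H (tensor_map id (hantipode ?H) (hcomult ?H x)) =
        scale (hcounit ?H x) (hone ?H)" for x
  proof -
    have neg: "- g + s + g + (- g - s + g) = 0" "- g = - g + h \<longleftrightarrow> h = 0" for g s h :: 'g
      by (metis add.assoc add.right_inverse add.left_inverse add_minus_cancel diff_conv_add_uminus
          minus_add_cancel add_0)
         (metis add.right_neutral add_left_cancel)
    have neg': "g = - (- g + h) \<longleftrightarrow> h = 0" for g h :: 'g
      by (metis neg(2) minus_minus)
    have neg'': "g - (- g + s + g) - g + s = 0" for g s :: 'g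
      by (metis (no_types, lifting) add.assoc add.right_inverse add_minus_cancel diff_conv_add_uminus
          minus_add minus_add_cancel minus_minus)
    have "mult_map ?H (tensor_map (hantipode ?H) id (hcomult ?H x)) (s, h) =
        (\<Sum>g\<in>UNIV. if h = 0 then x (0, - g) else 0)" for s h
      unfolding double_mult_map tensor_map_id_right[OF lin(4)] double_antipode_apply
        double_comult_apply
      by (intro sum.cong refl) (simp only: neg)
    moreover have "(\<Sum>g\<in>UNIV. x (0, - g)) = (\<Sum>g\<in>UNIV. x (0, g))"
      by (rule sum.reindex_bij_witness[of _ uminus uminus]) auto
    moreover have "mult_map ?H (tensor_map id (hantipode ?H) (hcomult ?H x)) (s, h) =
        (\<Sum>g\<in>UNIV. if h = 0 then x (0, g) else 0)" for s h
      unfolding double_mult_map tensor_map_id_left[OF lin(4)] double_antipode_apply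
        double_comult_apply
      by (intro sum.cong refl) (simp only: neg' split: if_split, simp add: neg'')
    ultimately show "mult_map ?H (tensor_map (hantipode ?H) id (hcomult ?H x)) =
        scale (hcounit ?H x) (hone ?H)"
      "mult_map ?H (tensor_map id (hantipode ?H) (hcomult ?H x)) =
        scale (hcounit ?H x) (hone ?H)"
      by (auto simp: fun_eq_iff scale_def double_one_apply double_counit_apply)
  qed
  show ?thesis
    unfolding hopf_algebra_def
    using lin eps assoc unit coassoc counit comult_mult comult_one counit_mult counit_one antipode
    by blast
qed

lemma double_mult_bowtie:
  "hmult group_double (f \<bowtie> delta g) (f' \<bowtie> delta g') = (f * conj_act g f' \<bowtie> delta (g + g'))"
proof -
  have "hmult group_double (f \<bowtie> delta g) (f' \<bowtie> delta g') (s, h) =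
      (\<Sum>l\<in>UNIV. if l = g then (f * conj_act g f' \<bowtie> delta (g + g')) (s, h) else 0)" for s h
    unfolding double_mult_apply
    by (intro sum.cong refl)
       (auto simp: bowtie_def tensor_def conj_act_apply delta_mult delta_apply)
  then show ?thesis
    by (auto simp: fun_eq_iff)
qed

end

theory Submission
  imports Defs
begin

text \<open>Write \<open>F i\<close> for the \<open>i\<close>-th row of \<open>R\<close>, so that \<open>R = (\<Sum>i. delta i \<otimes> F i)\<close>. Read through rows,
  the two hexagon axioms say that \<open>F\<close> turns the product and the coproduct dual to those of \<open>H\<close> into the
  product and the opposite coproduct of \<open>H\<close>. The inverse of \<open>R\<close> is \<open>(S \<otimes> id) R\<close>, hence
  \<open>u\<^sub>R = (\<Sum>i. F i S(delta i))\<close>.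

  \<^emph>\<open>The ribbon axioms.\<close> In any Hopf algebra with anti-multiplicative involutory antipode, a Drinfel'd
  element that is central, fixed by \<open>S\<close> and of counit 1 is a ribbon element
  (\<open>ribbon_drinfeld_element\<close>). Only the formula for \<open>\<Delta>(u\<^sub>R)\<close> needs work. The element
  \<open>w = (\<Sum>i. F i (delta i))\<close> is inverse to \<open>u\<^sub>R\<close>, so it suffices to show
  \<open>\<Delta>(w) = (w \<otimes> w) \<tau>(R) R\<close>. The second hexagon gives
  \<open>(\<Sum>i. \<Delta>(F i) (1 \<otimes> delta i)) = (1 \<otimes> w) \<tau>(R)\<close> and, after a flip,
  \<open>(\<Sum>i. \<tau>(\<Delta>(F i)) (delta i \<otimes> 1)) = (w \<otimes> 1) R\<close>. As \<open>w\<close> is central, the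
  product of the two right-hand sides is \<open>(w \<otimes> w) \<tau>(R) R\<close>. As \<open>\<tau>(R)\<close> turns \<open>\<tau>(\<Delta>(F i))\<close> into
  \<open>\<Delta>(F i)\<close>, it is also \<open>\<Sum>i j. \<Delta>(F i F j) (delta i \<otimes> delta j)\<close>, which the first hexagon
  collapses to \<open>\<Delta>(w)\<close>.

  \<^emph>\<open>The three hypotheses for the double.\<close> Commutation of \<open>R\<close> with the coproducts of the \<open>e\<^sub>y \<bowtie> 1\<close>
  and of the \<open>1 \<bowtie> g\<close> means that \<open>R\<close> is invariant under simultaneous conjugation and that its
  coefficient at \<open>(e\<^sub>s \<bowtie> h) \<otimes> (e\<^sub>t \<bowtie> k)\<close> vanishes unless
  \<open>s t = (k\<^sup>-\<^sup>1 t k) (h\<^sup>-\<^sup>1 s h)\<close>. The second fact reduces \<open>u\<^sub>R\<close> to a single sum: its coefficient at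
  \<open>e\<^sub>t \<bowtie> k\<close> is the sum over \<open>h\<close> of the coefficients of \<open>R\<close> at
  \<open>(e\<^bsub>t\<^sup>-\<^sup>1\<^esub> \<bowtie> h) \<otimes> (e\<^sub>t \<bowtie> k h)\<close>. So \<open>u\<^sub>R\<close> is invariant under conjugation and supported on commuting
  pairs, which makes it central. Together with \<open>(S \<otimes> S) R = R\<close> the same sum shows that \<open>S\<close> fixes it.

  \<^emph>\<open>The formula.\<close> The support condition and idempotency of the \<open>p(e\<^sub>h)\<close> force \<open>p\<close> to live on the centre
  of the group on both sides. Once that is known the rows factor as
  \<open>F(e\<^sub>h # 1) = (\<Sum>l. u(e\<^sub>l) \<bowtie> p(e\<^bsub>l\<^sup>-\<^sup>1 h\<^esub>))\<close> and \<open>F(\<epsilon> # s) = r(s) \<bowtie> v(s)\<close>, with all conjugations by elements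
  in the support of \<open>p\<close> gone, and the single sum for \<open>u\<^sub>R\<close> becomes the asserted one.\<close>


section \<open>Linear maps and tensors\<close>

lemma linear_map_zero: "linear_map f \<Longrightarrow> f 0 = 0"
  unfolding linear_map_def by (metis add_cancel_right_left)

lemma linear_map_add: "linear_map f \<Longrightarrow> f (x + y) = f x + f y"
  and linear_map_scale: "linear_map f \<Longrightarrow> f (scale c x) = scale c (f x)"
  unfolding linear_map_def by blast+

lemma linear_map_sum_commute: "linear_map f \<Longrightarrow> f (\<Sum>a\<in>A. y a) = (\<Sum>a\<in>A. f (y a))"
  by (induction A rule: infinite_finite_induct) (auto simp: linear_map_zero linear_map_add)

lemma linear_map_comp: "linear_map f \<Longrightarrow> linear_map g \<Longrightarrow> linear_map (\<lambda>x. f (g x))"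
  by (simp add: linear_map_def)

lemma linear_map_ident: "linear_map (\<lambda>x. x)"
  by (simp add: linear_map_def)

lemma delta_expand: "x = (\<Sum>a\<in>UNIV. scale (x a) (delta a))" for x :: "'a::finite \<Rightarrow> 'k::field"
  by (simp add: fun_eq_iff sum_fun_apply scale_def delta_apply if_distrib cong: if_cong)

lemma linear_map_expand_fun:
  fixes x :: "'a::finite \<Rightarrow> 'k::field"
  assumes "linear_map f"
  shows "(\<Sum>a\<in>UNIV. scale (x a) (f (delta a))) = f x"
  using linear_map_expand[OF assms] by (auto simp: fun_eq_iff sum_fun_apply scale_def)

lemma linear_map_eqI:
  fixes f g :: "('a::finite \<Rightarrow> 'k::field) \<Rightarrow> 'b \<Rightarrow> 'k"
  assumes "linear_map f" "linear_map g" "\<And>a. f (delta a) = g (delta a)"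
  shows "f x = g x"
  by (metis (no_types, lifting) linear_map_expand_fun assms sum.cong)

lemma lin_ext_delta: "lin_ext \<phi> (delta a) = \<phi> a"
  by (simp add: fun_eq_iff lin_ext_apply delta_apply if_distrib[of "\<lambda>c. c * _"] cong: if_cong)

lemma linear_tensor: "linear_map (tensor x)" "linear_map (\<lambda>x. tensor x y)"
  by (auto simp: linear_map_def tensor_def scale_def fun_eq_iff algebra_simps)

lemma delta_pair: "delta (a, b) = tensor (delta a) (delta b)"
  by (auto simp: fun_eq_iff tensor_def delta_apply)

lemma linear_flip: "linear_map flip"
  by (auto simp: linear_map_def flip_def scale_def fun_eq_iff)

lemma flip_tensor: "flip (tensor x y) = tensor y x"
  by (auto simp: flip_def tensor_def fun_eq_iff)

lemma flip_flip: "flip (flip t) = t"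
  by (auto simp: flip_def fun_eq_iff)

lemma linear_tensor_mult: "linear_map (tensor_mult m n X)" "linear_map (\<lambda>X. tensor_mult m n X Y)"
  unfolding tensor_mult_def by (rule linear_map_bilin_ext)+

text \<open>\<^const>\<open>tensor_mult\<close> prescribes the product of basis tensors; bilinearity extends it, one factor at a
  time, to arbitrary pure tensors.\<close>

lemma tensor_mult_tensor:
  assumes "\<And>x. linear_map (m x)" "\<And>y. linear_map (\<lambda>x. m x y)"
    and "\<And>x. linear_map (n x)" "\<And>y. linear_map (\<lambda>x. n x y)"
  shows "tensor_mult m n (tensor a b) (tensor c d) = tensor (m a c) (n b d)"
proof -
  have basis: "tensor_mult m n (tensor (delta a) (delta b)) (tensor (delta c) (delta d)) =
      tensor (m (delta a) (delta c)) (n (delta b) (delta d))" for a b c d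
    unfolding tensor_mult_def delta_pair[symmetric]
    by (auto simp: fun_eq_iff bilin_ext_apply delta_apply if_distrib[of "\<lambda>c. c * _"]
        if_distrib[of "\<lambda>c. _ * c"]
        cong: if_cong)
  note lin = linear_tensor_mult linear_tensor assms
  note comp = lin[THEN linear_map_comp]
  have 1: "tensor_mult m n (tensor a (delta b)) (tensor (delta c) (delta d)) =
      tensor (m a (delta c)) (n (delta b) (delta d))" for b c d
    by (rule linear_map_eqI[where x = a]) (rule lin | rule comp | simp add: basis)+
  have 2: "tensor_mult m n (tensor a b) (tensor (delta c) (delta d)) =
      tensor (m a (delta c)) (n b (delta d))" for c d
    by (rule linear_map_eqI[where x = b]) (rule lin | rule comp | simp add: 1)+
  have 3: "tensor_mult m n (tensor a b) (tensor c (delta d)) =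
      tensor (m a c) (n b (delta d))" for d
    by (rule linear_map_eqI[where x = c]) (rule lin | rule comp | simp add: 2)+
  show ?thesis
    by (rule linear_map_eqI[where x = d]) (rule lin | rule comp | simp add: 3)+
qed

text \<open>The element \<open>(\<phi> \<otimes> id) R\<close> for the coordinate functional \<open>\<phi>\<close> dual to \<open>delta a\<close>.\<close>

definition row :: "('a \<times> 'b \<Rightarrow> 'k) \<Rightarrow> 'a \<Rightarrow> 'b \<Rightarrow> 'k" where
  "row R a = (\<lambda>b. R (a, b))"

lemma tensor_rows: "R = (\<Sum>a\<in>UNIV. tensor (delta a) (row R a))" for R :: "'a::finite \<times> 'b \<Rightarrow> 'k::field"
  by (auto simp: fun_eq_iff sum_fun_apply tensor_def delta_apply row_def if_distrib[of "\<lambda>c. c * _"]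
      cong: if_cong)

lemma flip_rows: "flip R = (\<Sum>a\<in>UNIV. tensor (row R a) (delta a))" for R :: "'a::finite \<times> 'b \<Rightarrow> 'k::field"
  by (subst tensor_rows[of R]) (simp add: linear_map_sum_commute[OF linear_flip] flip_tensor)

section \<open>Quasitriangular Hopf algebras through the rows of the R-matrix\<close>

locale quasitriangular_hopf =
  fixes H :: "('b::finite, 'k::field) hopf_data" and R :: "'b \<times> 'b \<Rightarrow> 'k"
  assumes hopf: "hopf_algebra H" and quasitriangular: "quasitriangular H R"
begin

abbreviation mul (infixl "\<odot>" 70) where "x \<odot> y \<equiv> hmult H x y"
abbreviation mul2 (infixl "\<odot>\<odot>" 70) where "X \<odot>\<odot> Y \<equiv> mult2 H X Y"
abbreviation S where "S \<equiv> hantipode H"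
abbreviation \<Delta> where "\<Delta> \<equiv> hcomult H"
abbreviation F where "F \<equiv> row R"

lemma linear_mul: "linear_map (\<lambda>y. x \<odot> y)" "linear_map (\<lambda>x. x \<odot> y)"
  and linear_comult: "linear_map \<Delta>" and linear_antipode: "linear_map S"
  and mul_assoc: "x \<odot> y \<odot> z = x \<odot> (y \<odot> z)"
  and mul_one: "hone H \<odot> x = x" "x \<odot> hone H = x"
  and comult_mul: "\<Delta> (x \<odot> y) = \<Delta> x \<odot>\<odot> \<Delta> y"
  and comult_one: "\<Delta> (hone H) = one2 H"
  and antipode: "mult_map H (tensor_map S id (\<Delta> x)) = scale (hcounit H x) (hone H)"
    "mult_map H (tensor_map id S (\<Delta> x)) = scale (hcounit H x) (hone H)"
  using hopf unfolding hopf_algebra_def by (simp_all)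

lemma linear_mul2: "linear_map (\<lambda>Y. X \<odot>\<odot> Y)" "linear_map (\<lambda>X. X \<odot>\<odot> Y)"
  unfolding mult2_def by (fact linear_tensor_mult)+

lemma mul2_tensor: "tensor a b \<odot>\<odot> tensor c d = tensor (a \<odot> c) (b \<odot> d)"
  unfolding mult2_def by (intro tensor_mult_tensor linear_mul)

lemmas sum_out = linear_mul[THEN linear_map_sum_commute] linear_mul2[THEN linear_map_sum_commute]
  linear_tensor[THEN linear_map_sum_commute] linear_flip[THEN linear_map_sum_commute]
  linear_comult[THEN linear_map_sum_commute] linear_antipode[THEN linear_map_sum_commute]

lemmas scale_out = linear_mul[THEN linear_map_scale] linear_mul2[THEN linear_map_scale]
  linear_tensor[THEN linear_map_scale] linear_flip[THEN linear_map_scale]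
  linear_comult[THEN linear_map_scale] linear_antipode[THEN linear_map_scale]

lemma mul2_assoc: "X \<odot>\<odot> Y \<odot>\<odot> Z = X \<odot>\<odot> (Y \<odot>\<odot> Z)"
proof -
  note lin = linear_mul2
  note comp = lin[THEN linear_map_comp]
  have 1: "X \<odot>\<odot> delta b \<odot>\<odot> delta c = X \<odot>\<odot> (delta b \<odot>\<odot> delta c)" for b c
    by (rule linear_map_eqI[where x = X])
       (rule lin | rule comp | cases b, cases c, auto simp: delta_pair mul2_tensor mul_assoc)+
  have 2: "X \<odot>\<odot> Y \<odot>\<odot> delta c = X \<odot>\<odot> (Y \<odot>\<odot> delta c)" for c
    by (rule linear_map_eqI[where x = Y]) (rule lin | rule comp | simp add: 1)+
  show ?thesis
    by (rule linear_map_eqI[where x = Z]) (rule lin | rule comp | simp add: 2)+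
qed

lemma mul2_one: "one2 H \<odot>\<odot> X = X" "X \<odot>\<odot> one2 H = X"
  by (rule linear_map_eqI[where x = X],
      (rule linear_mul2 linear_map_ident | auto simp: one2_def delta_pair mul2_tensor mul_one)+)+

lemma flip_mul2: "flip (X \<odot>\<odot> Y) = flip X \<odot>\<odot> flip Y"
proof -
  note lin = linear_mul2 linear_flip
  note comp = lin[THEN linear_map_comp]
  have 1: "flip (X \<odot>\<odot> delta b) = flip X \<odot>\<odot> flip (delta b)" for b
    by (rule linear_map_eqI[where x = X])
       (rule lin | rule comp | cases b, auto simp: delta_pair mul2_tensor flip_tensor)+
  show ?thesis
    by (rule linear_map_eqI[where x = Y]) (rule lin | rule comp | simp add: 1)+
qed

lemma mult_map_tensor: "mult_map H (tensor x y) = x \<odot> y"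
proof -
  note lin = linear_map_lin_ext linear_tensor linear_mul
  note comp = lin[THEN linear_map_comp]
  have 1: "mult_map H (tensor x (delta b)) = x \<odot> delta b" for b
    unfolding mult_map_def
    by (rule linear_map_eqI[where x = x])
       (rule lin | rule comp | simp only: delta_pair[symmetric] lin_ext_delta prod.case)+
  show ?thesis
    by (rule linear_map_eqI[where x = y])
       (unfold mult_map_def, (rule lin | rule comp)+, fold mult_map_def, rule 1)
qed

lemma linear_mult_map: "linear_map (mult_map H)"
  unfolding mult_map_def by (rule linear_map_lin_ext)

lemma leg_rows:
  "leg12 H R = (\<Sum>i\<in>UNIV. tensor (delta i) (tensor (F i) (hone H)))"
  "leg13 H R = (\<Sum>i\<in>UNIV. tensor (delta i) (tensor (hone H) (F i)))"
  "leg23 H R = (\<Sum>i\<in>UNIV. tensor (hone H) (tensor (delta i) (F i)))"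
  by (auto simp: fun_eq_iff sum_fun_apply tensor_def delta_apply row_def leg12_def leg13_def leg23_def
      if_distrib[of "\<lambda>c. c * _"] if_distrib[of "\<lambda>c. _ * c"] cong: if_cong)

lemma mult3_sum:
  "mult3 H (\<Sum>i\<in>A. f i) (\<Sum>j\<in>B. g j) = (\<Sum>i\<in>A. \<Sum>j\<in>B. mult3 H (f i) (g j))"
  unfolding mult3_def
  by (simp add: linear_tensor_mult[THEN linear_map_sum_commute]) (rule sum.swap)

lemma mult3_tensor:
  "mult3 H (tensor x (tensor y z)) (tensor x' (tensor y' z')) =
     tensor (x \<odot> x') (tensor (y \<odot> y') (z \<odot> z'))"
  unfolding mult3_def
  by (subst tensor_mult_tensor) (simp_all add: linear_mul linear_mul2 mul2_tensor)

text \<open>The axiom \<open>(\<Delta> \<otimes> id) R = R\<^sup>1\<^sup>3 R\<^sup>2\<^sup>3\<close>, compared at \<open>delta i \<otimes> delta j\<close> in the first two legs.\<close>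

lemma row_mul: "F i \<odot> F j = (\<Sum>m\<in>UNIV. scale (\<Delta> (delta m) (i, j)) (F m))"
proof
  fix c
  have "(\<Sum>m\<in>UNIV. scale (\<Delta> (delta m) (i, j)) (F m)) c = reassoc (tensor_map \<Delta> id R) (i, j, c)"
    using linear_map_expand[OF linear_comult, of "\<lambda>a. R (a, c)" "(i, j)"]
    by (simp add: reassoc_def tensor_map_id_right[OF linear_comult] sum_fun_apply scale_def row_def mult.commute)
  also have "\<dots> = mult3 H (leg13 H R) (leg23 H R) (i, j, c)"
    using quasitriangular by (simp add: quasitriangular_def)
  also have "\<dots> = (F i \<odot> F j) c"
    unfolding leg_rows mult3_sum mult3_tensor mul_one
    by (subst sum.swap)
       (simp add: sum_fun_apply tensor_def delta_apply if_distrib[of "\<lambda>c. c * _"] cong: if_cong)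
  finally show "(F i \<odot> F j) c = (\<Sum>m\<in>UNIV. scale (\<Delta> (delta m) (i, j)) (F m)) c" ..
qed

text \<open>The axiom \<open>(id \<otimes> \<Delta>) R = R\<^sup>1\<^sup>3 R\<^sup>1\<^sup>2\<close>, compared at \<open>delta m\<close> in the first leg. The second factor
  \<open>R\<^sup>1\<^sup>2\<close> occupies the middle leg, which is why \<open>F j\<close> comes before \<open>F i\<close>.\<close>

lemma comult_row:
  "\<Delta> (F m) = (\<Sum>i\<in>UNIV. \<Sum>j\<in>UNIV. scale ((delta i \<odot> delta j) m) (tensor (F j) (F i)))"
proof
  fix q
  have "\<Delta> (F m) q = tensor_map id \<Delta> R (m, q)"
    by (simp add: tensor_map_id_left[OF linear_comult] row_def)
  also have "\<dots> = mult3 H (leg13 H R) (leg12 H R) (m, q)"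
    using quasitriangular by (simp add: quasitriangular_def)
  also have "\<dots> = (\<Sum>i\<in>UNIV. \<Sum>j\<in>UNIV. scale ((delta i \<odot> delta j) m) (tensor (F j) (F i))) q"
    unfolding leg_rows mult3_sum mult3_tensor mul_one
    by (cases q) (simp add: sum_fun_apply tensor_def scale_def)
  finally show "\<Delta> (F m) q = \<dots>" .
qed

lemma row_counit: "hcounit H (F m) = hone H m"
proof -
  have lin: "linear_functional (hcounit H)"
    using hopf unfolding hopf_algebra_def by blast
  have s: "hcounit H (\<Sum>b\<in>A. scale (c b) (d b)) = (\<Sum>b\<in>A. c b * hcounit H (d b))" for A :: "'b set" and c d
  proof -
    have "hcounit H 0 = 0"
      using lin unfolding linear_functional_def by (metis add_cancel_right_left)
    with lin show ?thesis
      by (induction A rule: infinite_finite_induct) (auto simp: linear_functional_def)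
  qed
  have "hcounit H (F m) = (\<Sum>b\<in>UNIV. R (m, b) * hcounit H (delta b))"
    by (subst delta_expand) (simp add: s row_def)
  also have "\<dots> = contract_right (hcounit H) R m"
    unfolding contract_right_def lin_ext_apply sum_UNIV_prod
    by (subst sum.swap) (simp add: scale_def delta_apply if_distrib[of "\<lambda>c. _ * c"] cong: if_cong)
  finally show ?thesis
    using quasitriangular by (simp add: quasitriangular_def)
qed

lemma sum_counit_row: "(\<Sum>m\<in>UNIV. scale (hcounit H (delta m)) (F m)) = hone H"
proof -
  have "(\<Sum>m\<in>UNIV. scale (hcounit H (delta m)) (F m)) = contract_left (hcounit H) R"
    by (auto simp: fun_eq_iff contract_left_def lin_ext_apply sum_UNIV_prod sum_fun_apply scale_def
        delta_apply row_def
        if_distrib[of "\<lambda>c. _ * c"] mult.commute cong: if_cong)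
  then show ?thesis
    using quasitriangular by (simp add: quasitriangular_def)
qed

lemma tensor_map_antipode_left: "tensor_map S id R = (\<Sum>i\<in>UNIV. tensor (S (delta i)) (F i))"
proof -
  have "tensor_map S id R (c, d) = (\<Sum>i\<in>UNIV. tensor (S (delta i)) (F i)) (c, d)" for c d
    using linear_map_expand[OF linear_antipode, of "\<lambda>a. R (a, d)" c]
    by (simp add: tensor_map_id_right[OF linear_antipode] sum_fun_apply tensor_def row_def mult.commute)
  then show ?thesis by auto
qed

lemma tensor_map_antipode_right: "tensor_map id S R = (\<Sum>i\<in>UNIV. tensor (delta i) (S (F i)))"
proof -
  have "tensor_map id S R (c, d) = (\<Sum>i\<in>UNIV. tensor (delta i) (S (F i))) (c, d)" for c d
    by (simp add: tensor_map_id_left[OF linear_antipode] sum_fun_apply tensor_def row_def delta_apply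
        if_distrib[of "\<lambda>c. c * _"] cong: if_cong)
  then show ?thesis by auto
qed

lemma mult_map_tensor_map:
  "mult_map H (tensor_map f g X) = (\<Sum>i\<in>UNIV. \<Sum>j\<in>UNIV. scale (X (i, j)) (f (delta i) \<odot> g (delta j)))"
proof -
  have "tensor_map f g X = (\<Sum>i\<in>UNIV. \<Sum>j\<in>UNIV. scale (X (i, j)) (tensor (f (delta i)) (g (delta j))))"
    by (auto simp: fun_eq_iff tensor_map_apply sum_fun_apply scale_def tensor_def)
  then show ?thesis
    by (simp add: linear_mult_map[THEN linear_map_sum_commute] linear_mult_map[THEN linear_map_scale]
        mult_map_tensor)
qed

text \<open>Every double sum over rows of \<open>R\<close> that meets a product \<open>F i F j\<close> collapses to a single one in
  which the other leg is fed with a coproduct. With an antipode applied to one half of that coproduct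
  the other leg becomes a counit.\<close>

lemma sum_tensor_row_mul:
  "(\<Sum>i\<in>UNIV. \<Sum>j\<in>UNIV. tensor (c i j) (F i \<odot> F j)) =
     (\<Sum>m\<in>UNIV. tensor (\<Sum>i\<in>UNIV. \<Sum>j\<in>UNIV. scale (\<Delta> (delta m) (i, j)) (c i j)) (F m))"
proof -
  have "(\<Sum>i\<in>UNIV. \<Sum>j\<in>UNIV. tensor (c i j) (F i \<odot> F j)) =
      (\<Sum>i\<in>UNIV. \<Sum>j\<in>UNIV. \<Sum>m\<in>UNIV. scale (\<Delta> (delta m) (i, j)) (tensor (c i j) (F m)))"
    by (simp add: row_mul sum_out scale_out)
  also have "\<dots> = (\<Sum>i\<in>UNIV. \<Sum>m\<in>UNIV. \<Sum>j\<in>UNIV. scale (\<Delta> (delta m) (i, j)) (tensor (c i j) (F m)))"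
    by (intro sum.cong refl sum.swap)
  also have "\<dots> = (\<Sum>m\<in>UNIV. \<Sum>i\<in>UNIV. \<Sum>j\<in>UNIV. scale (\<Delta> (delta m) (i, j)) (tensor (c i j) (F m)))"
    by (rule sum.swap)
  finally show ?thesis
    by (simp add: sum_out scale_out)
qed

lemma sum_one_counit_row:
  "(\<Sum>m\<in>UNIV. tensor (scale (hcounit H (delta m)) x) (F m)) = tensor x (hone H)"
proof -
  have "(\<Sum>m\<in>UNIV. tensor (scale (hcounit H (delta m)) x) (F m)) =
      tensor x (\<Sum>m\<in>UNIV. scale (hcounit H (delta m)) (F m))"
    by (simp add: sum_out scale_out)
  then show ?thesis
    by (simp add: sum_counit_row)
qed

lemma antipode_leg_inverse:
  "R \<odot>\<odot> tensor_map S id R = one2 H" "tensor_map S id R \<odot>\<odot> R = one2 H"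
proof -
  have "R \<odot>\<odot> tensor_map S id R = (\<Sum>i\<in>UNIV. \<Sum>j\<in>UNIV. tensor (delta i \<odot> S (delta j)) (F i \<odot> F j))"
    by (subst tensor_rows[of R]) (simp add: tensor_map_antipode_left sum_out mul2_tensor, rule sum.swap)
  also have "\<dots> = (\<Sum>m\<in>UNIV. tensor (mult_map H (tensor_map id S (\<Delta> (delta m)))) (F m))"
    unfolding sum_tensor_row_mul mult_map_tensor_map by simp
  finally show "R \<odot>\<odot> tensor_map S id R = one2 H"
    by (simp add: antipode sum_one_counit_row one2_def)
  have "tensor_map S id R \<odot>\<odot> R = (\<Sum>i\<in>UNIV. \<Sum>j\<in>UNIV. tensor (S (delta i) \<odot> delta j) (F i \<odot> F j))"
    by (subst (2) tensor_rows[of R]) (simp add: tensor_map_antipode_left sum_out mul2_tensor, rule sum.swap)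
  also have "\<dots> = (\<Sum>m\<in>UNIV. tensor (mult_map H (tensor_map S id (\<Delta> (delta m)))) (F m))"
    unfolding sum_tensor_row_mul mult_map_tensor_map by simp
  finally show "tensor_map S id R \<odot>\<odot> R = one2 H"
    by (simp add: antipode sum_one_counit_row one2_def)
qed

text \<open>This identifies further expressions for the inverse of \<open>R\<close> from a one-sided computation.\<close>

lemma right_inverse_unique:
  assumes "R \<odot>\<odot> Q = one2 H"
  shows "Q = tensor_map S id R"
proof -
  have "Q = tensor_map S id R \<odot>\<odot> R \<odot>\<odot> Q"
    by (simp only: antipode_leg_inverse(2) mul2_one)
  also have "\<dots> = tensor_map S id R"
    by (simp only: mul2_assoc assms mul2_one)
  finally show ?thesis .
qed

lemma inverse2_eq: "inverse2 H R = tensor_map S id R"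
  unfolding inverse2_def by (rule the_equality) (blast intro: antipode_leg_inverse right_inverse_unique)+

lemma drinfeld_element_eq: "drinfeld_element H R = (\<Sum>i\<in>UNIV. F i \<odot> S (delta i))"
  by (simp add: drinfeld_element_def inverse2_eq tensor_map_antipode_left sum_out flip_tensor
      linear_mult_map[THEN linear_map_sum_commute] mult_map_tensor)

text \<open>The multiplication applied to \<open>\<tau>(R)\<close>. It turns out to be the inverse of the Drinfel'd element when
  the antipode is an involution.\<close>

definition row_product :: "'b \<Rightarrow> 'k" where
  "row_product = (\<Sum>i\<in>UNIV. F i \<odot> delta i)"

text \<open>By \<open>comult_row\<close> the left-hand side is \<open>\<Sum>i j. F j \<otimes> F i (delta i) (delta j)\<close>, in which the sum
  over \<open>i\<close> is the row product.\<close>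

lemma comult_row_delta: "(\<Sum>m\<in>UNIV. \<Delta> (F m) \<odot>\<odot> tensor (hone H) (delta m)) =
    tensor (hone H) row_product \<odot>\<odot> flip R"
proof -
  have "(\<Sum>m\<in>UNIV. \<Delta> (F m) \<odot>\<odot> tensor (hone H) (delta m)) =
      (\<Sum>m\<in>UNIV. \<Sum>i\<in>UNIV. \<Sum>j\<in>UNIV. scale ((delta i \<odot> delta j) m) (tensor (F j) (F i \<odot> delta m)))"
    by (simp add: comult_row sum_out scale_out mul2_tensor mul_one)
  also have "\<dots> = (\<Sum>i\<in>UNIV. \<Sum>m\<in>UNIV. \<Sum>j\<in>UNIV. scale ((delta i \<odot> delta j) m) (tensor (F j) (F i \<odot> delta m)))"
    by (rule sum.swap)
  also have "\<dots> = (\<Sum>i\<in>UNIV. \<Sum>j\<in>UNIV. \<Sum>m\<in>UNIV. scale ((delta i \<odot> delta j) m) (tensor (F j) (F i \<odot> delta m)))"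
    by (intro sum.cong refl sum.swap)
  also have "\<dots> = (\<Sum>i\<in>UNIV. \<Sum>j\<in>UNIV. tensor (F j) (F i \<odot> delta i \<odot> delta j))"
  proof (intro sum.cong refl)
    fix i j
    have "linear_map (\<lambda>x. tensor (F j) (F i \<odot> x))"
      by (rule linear_map_comp[OF linear_tensor(1) linear_mul(1)])
    from linear_map_expand_fun[OF this, of "delta i \<odot> delta j"]
    show "(\<Sum>m\<in>UNIV. scale ((delta i \<odot> delta j) m) (tensor (F j) (F i \<odot> delta m))) =
        tensor (F j) (F i \<odot> delta i \<odot> delta j)"
      by (simp only: mul_assoc)
  qed
  also have "\<dots> = tensor (hone H) row_product \<odot>\<odot> flip R"
    by (simp add: flip_rows sum_out row_product_def mul2_tensor mul_one) (rule sum.swap)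
  finally show ?thesis .
qed

lemma flip_comult_row_delta: "(\<Sum>m\<in>UNIV. flip (\<Delta> (F m)) \<odot>\<odot> tensor (delta m) (hone H)) =
    tensor row_product (hone H) \<odot>\<odot> R"
proof -
  have "(\<Sum>m\<in>UNIV. flip (\<Delta> (F m)) \<odot>\<odot> tensor (delta m) (hone H)) =
      flip (\<Sum>m\<in>UNIV. \<Delta> (F m) \<odot>\<odot> tensor (hone H) (delta m))"
    by (simp add: linear_flip[THEN linear_map_sum_commute] flip_mul2 flip_tensor)
  then show ?thesis
    by (simp add: comult_row_delta flip_mul2 flip_tensor flip_flip)
qed

lemma flip_comult: "flip R \<odot>\<odot> flip (\<Delta> h) = \<Delta> h \<odot>\<odot> flip R"
proof -
  have "flip (R \<odot>\<odot> \<Delta> h) = flip (flip (\<Delta> h) \<odot>\<odot> R)"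
    using quasitriangular by (simp add: quasitriangular_def)
  then show ?thesis
    by (simp add: flip_mul2 flip_flip)
qed

lemma central_leg2:
  assumes "\<And>h. w \<odot> h = h \<odot> w"
  shows "tensor (hone H) w \<odot>\<odot> X = X \<odot>\<odot> tensor (hone H) w"
  by (rule linear_map_eqI[where x = X])
     (rule linear_mul2 | auto simp: delta_pair mul2_tensor mul_one assms)+

lemma central_leg1:
  assumes "\<And>h. w \<odot> h = h \<odot> w"
  shows "tensor w (hone H) \<odot>\<odot> X = X \<odot>\<odot> tensor w (hone H)"
  by (rule linear_map_eqI[where x = X])
     (rule linear_mul2 | auto simp: delta_pair mul2_tensor mul_one assms)+

text \<open>Centrality lets the two copies of the row product pass to the places where \<open>comult_row_delta\<close> and its
  flip absorb them together with \<open>\<tau>(R)\<close> and \<open>R\<close>; the first hexagon then merges the two sums over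
  rows.\<close>

lemma comult_row_product:
  assumes central: "\<And>h. row_product \<odot> h = h \<odot> row_product"
  shows "\<Delta> row_product = tensor row_product row_product \<odot>\<odot> (flip R \<odot>\<odot> R)"
proof -
  let ?w1 = "tensor row_product (hone H)" and ?w2 = "tensor (hone H) row_product"
  have "tensor row_product row_product = ?w2 \<odot>\<odot> ?w1"
    by (simp add: mul2_tensor mul_one)
  then have "tensor row_product row_product \<odot>\<odot> (flip R \<odot>\<odot> R) = ?w2 \<odot>\<odot> (flip R \<odot>\<odot> (?w1 \<odot>\<odot> R))"
    by (simp only: mul2_assoc flip: mul2_assoc[of "flip R" ?w1] central_leg1[OF central, of "flip R"])
  also have "\<dots> = (\<Sum>m\<in>UNIV. ?w2 \<odot>\<odot> (\<Delta> (F m) \<odot>\<odot> flip R \<odot>\<odot> tensor (delta m) (hone H)))"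
    by (simp add: flip_comult_row_delta[symmetric] sum_out flip_comult[symmetric] mul2_assoc)
  also have "\<dots> = (\<Sum>m\<in>UNIV. \<Delta> (F m) \<odot>\<odot> (?w2 \<odot>\<odot> flip R) \<odot>\<odot> tensor (delta m) (hone H))"
    by (simp only: mul2_assoc[symmetric] central_leg2[OF central, of "\<Delta> _"])
  also have "\<dots> = (\<Sum>m\<in>UNIV. \<Sum>j\<in>UNIV. \<Delta> (F m \<odot> F j) \<odot>\<odot> tensor (delta m) (delta j))"
    by (simp add: comult_row_delta[symmetric] sum_out comult_mul mul2_assoc mul2_tensor mul_one)
  also have "\<dots> = (\<Sum>i\<in>UNIV. \<Sum>j\<in>UNIV. \<Sum>m\<in>UNIV. \<Delta> (F m) \<odot>\<odot> scale (\<Delta> (delta m) (i, j)) (delta (i, j)))"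
    by (simp add: row_mul sum_out scale_out delta_pair)
  also have "\<dots> = (\<Sum>m\<in>UNIV. \<Delta> (F m) \<odot>\<odot> (\<Sum>p\<in>UNIV. scale (\<Delta> (delta m) p) (delta p)))"
  proof -
    have "(\<Sum>i\<in>UNIV. \<Sum>j\<in>UNIV. \<Sum>m\<in>UNIV. f i j m) = (\<Sum>m\<in>UNIV. \<Sum>p\<in>UNIV. f (fst p) (snd p) m)"
      for f :: "'b \<Rightarrow> 'b \<Rightarrow> 'b \<Rightarrow> 'b \<times> 'b \<Rightarrow> 'k"
    proof -
      have "(\<Sum>m\<in>UNIV. \<Sum>p\<in>UNIV. f (fst p) (snd p) m) = (\<Sum>p\<in>UNIV. \<Sum>m\<in>UNIV. f (fst p) (snd p) m)"
        by (rule sum.swap)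
      then show ?thesis
        by (simp add: sum_UNIV_prod)
    qed
    then show ?thesis
      by (simp add: linear_mul2[THEN linear_map_sum_commute])
  qed
  also have "\<dots> = (\<Sum>m\<in>UNIV. \<Delta> (F m) \<odot>\<odot> \<Delta> (delta m))"
    by (simp only: delta_expand[symmetric])
  also have "\<dots> = \<Delta> row_product"
    by (simp add: row_product_def sum_out comult_mul)
  finally show ?thesis ..
qed

end

section \<open>Involutory antipode\<close>

locale involutory_quasitriangular_hopf = quasitriangular_hopf H R
  for H :: "('b::finite, 'k::field) hopf_data" and R +
  assumes antipode_mul: "S (x \<odot> y) = S y \<odot> S x" and antipode_antipode: "S (S x) = x"
begin

lemma antipode_one: "S (hone H) = hone H"
  by (metis antipode_mul antipode_antipode mul_one)

text \<open>Both sides are inverse to \<open>R\<close>, so that \<open>(S \<otimes> S) R = R\<close>. The antipode axiom for \<open>F m\<close> evaluates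
  \<open>R (id \<otimes> S) R\<close> only after an application of \<open>S\<close>, because the rows reverse the coproduct; this is
  where the antipode has to be an anti-multiplicative involution.\<close>

lemma antipode_legs: "tensor_map S id R = tensor_map id S R"
proof -
  have *: "(\<Sum>i\<in>UNIV. \<Sum>j\<in>UNIV. scale ((delta i \<odot> delta j) m) (F i \<odot> S (F j))) =
      scale (hone H m) (hone H)" for m
  proof -
    have "(\<Sum>i\<in>UNIV. \<Sum>j\<in>UNIV. scale ((delta i \<odot> delta j) m) (F i \<odot> S (F j))) =
        S (\<Sum>i\<in>UNIV. \<Sum>j\<in>UNIV. scale ((delta i \<odot> delta j) m) (F j \<odot> S (F i)))"
      by (simp add: sum_out scale_out antipode_mul antipode_antipode)
    also have "(\<Sum>i\<in>UNIV. \<Sum>j\<in>UNIV. scale ((delta i \<odot> delta j) m) (F j \<odot> S (F i))) =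
        mult_map H (tensor_map id S (\<Delta> (F m)))"
    proof -
      have "tensor_map id S (tensor x y) = tensor x (S y)" for x y :: "'b \<Rightarrow> 'k"
        by (auto simp: fun_eq_iff tensor_map_id_left[OF linear_antipode] tensor_def
            linear_antipode[THEN linear_map_scale, unfolded scale_def])
      moreover have "linear_map (tensor_map (id :: ('b \<Rightarrow> 'k) \<Rightarrow> 'b \<Rightarrow> 'k) S)"
        unfolding tensor_map_def by (rule linear_map_lin_ext)
      note sums = this[THEN linear_map_sum_commute] this[THEN linear_map_scale]
        linear_mult_map[THEN linear_map_sum_commute] linear_mult_map[THEN linear_map_scale]
      ultimately show ?thesis
        by (simp only: comult_row mult_map_tensor sums)
    qed
    finally show ?thesis
      by (simp add: antipode row_counit scale_out antipode_one)
  qed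
  have "R \<odot>\<odot> tensor_map id S R = (\<Sum>i\<in>UNIV. \<Sum>j\<in>UNIV. tensor (delta i \<odot> delta j) (F i \<odot> S (F j)))"
    by (subst tensor_rows[of R]) (simp add: tensor_map_antipode_right sum_out mul2_tensor, rule sum.swap)
  also have "\<dots> = one2 H"
  proof -
    have "(\<Sum>i\<in>UNIV. \<Sum>j\<in>UNIV. tensor (delta i \<odot> delta j) (F i \<odot> S (F j))) (a, b) =
        one2 H (a, b)" for a b
    proof -
      have "(\<Sum>i\<in>UNIV. \<Sum>j\<in>UNIV. tensor (delta i \<odot> delta j) (F i \<odot> S (F j))) (a, b) =
          (\<Sum>i\<in>UNIV. \<Sum>j\<in>UNIV. scale ((delta i \<odot> delta j) a) (F i \<odot> S (F j))) b"
        by (simp add: sum_fun_apply tensor_def scale_def)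
      also have "\<dots> = one2 H (a, b)"
        unfolding * by (simp add: one2_def tensor_def scale_def)
      finally show ?thesis .
    qed
    then show ?thesis
      by auto
  qed
  finally show ?thesis
    by (rule right_inverse_unique[symmetric])
qed

lemma sum_scale_comult_antipode:
  "(\<Sum>i\<in>UNIV. \<Sum>j\<in>UNIV. scale (\<Delta> x (i, j)) (S (delta j) \<odot> delta i)) = scale (hcounit H x) (hone H)"
proof -
  have "(\<Sum>i\<in>UNIV. \<Sum>j\<in>UNIV. scale (\<Delta> x (i, j)) (S (delta j) \<odot> delta i)) =
      S (mult_map H (tensor_map S id (\<Delta> x)))"
    by (simp add: mult_map_tensor_map sum_out scale_out antipode_mul antipode_antipode)
  then show ?thesis
    by (simp add: antipode scale_out antipode_one)
qed

text \<open>Moving the central Drinfel'd element inside gives \<open>\<Sum>i j. F i F j S(delta j) (delta i)\<close>, which the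
  antipode axiom for the opposite product contracts to 1.\<close>

lemma row_product_drinfeld_element:
  assumes central: "\<And>h. drinfeld_element H R \<odot> h = h \<odot> drinfeld_element H R"
  shows "row_product \<odot> drinfeld_element H R = hone H"
proof -
  have "row_product \<odot> drinfeld_element H R = (\<Sum>i\<in>UNIV. F i \<odot> drinfeld_element H R \<odot> delta i)"
    unfolding row_product_def sum_out mul_assoc central[of "delta _"] ..
  also have "\<dots> = (\<Sum>i\<in>UNIV. \<Sum>j\<in>UNIV. F i \<odot> F j \<odot> (S (delta j) \<odot> delta i))"
    by (simp add: drinfeld_element_eq sum_out mul_assoc)
  also have "\<dots> = mult_map H (flip (\<Sum>i\<in>UNIV. \<Sum>j\<in>UNIV. tensor (S (delta j) \<odot> delta i) (F i \<odot> F j)))"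
    by (simp add: sum_out flip_tensor linear_mult_map[THEN linear_map_sum_commute] mult_map_tensor)
  also have "\<dots> = mult_map H (flip (tensor (hone H) (hone H)))"
    by (simp add: sum_tensor_row_mul sum_scale_comult_antipode sum_one_counit_row)
  finally show ?thesis
    by (simp add: flip_tensor mult_map_tensor mul_one)
qed

text \<open>With \<open>S(u) = u\<close> the condition \<open>\<nu>\<^sup>2 = u S(u)\<close> is trivial for \<open>\<nu> = u\<close>, and the coproduct condition is
  the inverse of \<open>comult_row_product\<close>.\<close>

theorem ribbon_drinfeld_element:
  assumes central: "\<And>h. drinfeld_element H R \<odot> h = h \<odot> drinfeld_element H R"
    and antipode_fixed: "S (drinfeld_element H R) = drinfeld_element H R"
    and counit: "hcounit H (drinfeld_element H R) = 1"
  shows "ribbon_element H R (drinfeld_element H R)"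
proof -
  let ?u = "drinfeld_element H R" and ?w = row_product
  have wu: "?w \<odot> ?u = hone H" and uw: "?u \<odot> ?w = hone H"
    using row_product_drinfeld_element[OF central] central by simp_all
  have "?w \<odot> h = h \<odot> ?w" for h
  proof -
    have "?w \<odot> h = ?w \<odot> (h \<odot> ?u) \<odot> ?w"
      by (simp only: mul_assoc uw mul_one)
    also have "\<dots> = ?w \<odot> (?u \<odot> h) \<odot> ?w"
      by (simp only: central)
    also have "\<dots> = h \<odot> ?w"
      by (simp only: mul_assoc[symmetric] wu mul_one)
    finally show ?thesis .
  qed
  note comult_w = comult_row_product[OF this]
  have "flip R \<odot>\<odot> R \<odot>\<odot> \<Delta> ?u = tensor ?u ?u \<odot>\<odot> (tensor ?w ?w \<odot>\<odot> (flip R \<odot>\<odot> R \<odot>\<odot> \<Delta> ?u))"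
    by (simp only: mul2_assoc[symmetric] mul2_tensor uw one2_def[symmetric] mul2_one)
  also have "\<dots> = tensor ?u ?u \<odot>\<odot> \<Delta> (?w \<odot> ?u)"
    by (simp add: comult_w comult_mul mul2_assoc)
  also have "\<dots> = tensor ?u ?u"
    by (simp add: wu comult_one mul2_one)
  finally show ?thesis
    unfolding ribbon_element_def antipode_fixed counit using central uw wu by blast
qed

end


section \<open>Ribbon structure of the double of a finite group\<close>

text \<open>As rewrite rules these bring a word in a non-commutative group into reduced form.\<close>

lemmas group_norm = add.assoc minus_add diff_conv_add_uminus minus_minus minus_add_cancel
  add_minus_cancel add_0_left add_0_right left_minus right_minus minus_zero

lemma neg_add_eq_iff: "- g + h = k \<longleftrightarrow> h = g + k" for g h k :: "'g::group_add"
proof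
  assume "- g + h = k"
  then have "g + (- g + h) = g + k"
    by simp
  then show "h = g + k"
    by (simp only: add_minus_cancel)
qed (simp only: minus_add_cancel)

lemma double_antipode_mult:
  "hantipode group_double (hmult group_double x y) =
     hmult group_double (hantipode group_double y) (hantipode group_double x)"
proof -
  have "hantipode group_double (hmult group_double x y) (s, h) =
     hmult group_double (hantipode group_double y) (hantipode group_double x) (s, h)" for s h
    unfolding double_antipode_apply double_mult_apply
    by (subst sum_shift[of _ "- h"]) (simp only: group_norm mult.commute)
  then show ?thesis
    by auto
qed

lemma double_antipode_antipode: "hantipode group_double (hantipode group_double x) = x"
  by (auto simp: fun_eq_iff double_antipode_apply group_norm simp del: add_uminus_conv_diff)

locale quasitriangular_double =
  fixes R :: "('g::{finite,group_add}, 'k::field) double2"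
  assumes quasitriangular_double: "quasitriangular group_double R"

sublocale quasitriangular_double \<subseteq> involutory_quasitriangular_hopf group_double R
  by unfold_locales
     (fact hopf_algebra_group_double quasitriangular_double double_antipode_mult
       double_antipode_antipode)+

context quasitriangular_double
begin

abbreviation double_mul (infixl "\<odot>" 70) where "x \<odot> y \<equiv> hmult group_double x y"
abbreviation double_mul2 (infixl "\<odot>\<odot>" 70) where "X \<odot>\<odot> Y \<equiv> mult2 group_double X Y"

text \<open>Both sides of \<open>R \<Delta>(e\<^sub>y \<bowtie> 1) = \<tau>(\<Delta>(e\<^sub>y \<bowtie> 1)) R\<close> pick out coefficients of \<open>R\<close>: the right one those
  with \<open>s t = y\<close>, the left one those with \<open>(k\<^sup>-\<^sup>1 t k) (h\<^sup>-\<^sup>1 s h) = y\<close>.\<close>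

lemma support:
  assumes "R ((s, h), (t, k)) \<noteq> 0"
  shows "s + t = (- k + t + k) + (- h + s + h)"
proof -
  let ?e = "delta (s + t) \<bowtie> delta 0 :: 'g \<times> 'g \<Rightarrow> 'k"
  have e: "\<Delta> ?e ((a, g), (b, l)) =
      (if g = 0 then if l = 0 then if b + a = s + t then 1 else 0 else 0 else 0)"
    for a g b l
    by (auto simp: double_comult_apply bowtie_def tensor_def delta_apply)
  have eq: "(R \<odot>\<odot> \<Delta> ?e) ((s, h), (t, k)) = (flip (\<Delta> ?e) \<odot>\<odot> R) ((s, h), (t, k))"
    using quasitriangular by (simp add: quasitriangular_def)
  have "(R \<odot>\<odot> \<Delta> ?e) ((s, h), (t, k)) =
     (\<Sum>g\<in>UNIV. \<Sum>l\<in>UNIV. if l = k then if g = h then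
        if (- k + t + k) + (- h + s + h) = s + t then R ((s, h), (t, k)) else 0 else 0 else 0)"
    unfolding double_mult2 e by (intro sum.cong refl) (auto simp: neg_add_eq_iff)
  moreover have "(flip (\<Delta> ?e) \<odot>\<odot> R) ((s, h), (t, k)) =
     (\<Sum>g\<in>UNIV. \<Sum>l\<in>UNIV. if l = (0::'g) then if g = (0::'g) then R ((s, h), (t, k)) else 0 else 0)"
    unfolding double_mult2 flip_def prod.case e
    by (rule sum.cong[OF refl], rule sum.cong[OF refl]) auto
  ultimately show ?thesis
    using eq assms by (auto split: if_splits)
qed

text \<open>This is \<open>R \<Delta>(1 \<bowtie> g) = \<tau>(\<Delta>(1 \<bowtie> g)) R\<close>, where \<open>1 \<bowtie> g\<close> is group-like.\<close>

lemma conj_invariant: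
  "R ((g + s - g, g + h - g), (g + t - g, g + k - g)) = R ((s, h), (t, k))"
proof -
  let ?e = "1 \<bowtie> delta g :: 'g \<times> 'g \<Rightarrow> 'k"
  have e: "\<Delta> ?e ((a, p), (b, q)) = (if p = g then if q = g then 1 else 0 else 0)" for a p b q
    by (auto simp: double_comult_apply bowtie_def tensor_def delta_apply)
  have eq: "(R \<odot>\<odot> \<Delta> ?e) ((x, a), (y, b)) = (flip (\<Delta> ?e) \<odot>\<odot> R) ((x, a), (y, b))" for x a y b
    using quasitriangular by (simp add: quasitriangular_def)
  have 1: "(R \<odot>\<odot> \<Delta> ?e) ((x, a), (y, b)) =
     (\<Sum>p\<in>UNIV. \<Sum>q\<in>UNIV. if q = b - g then if p = a - g then R ((x, p), (y, q)) else 0 else 0)"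
    for x a y b
  proof -
    have iff: "- p + a = g \<longleftrightarrow> p = a - g" for p a
      unfolding neg_add_eq_iff by (auto simp: group_norm simp del: add_uminus_conv_diff)
    show ?thesis
      unfolding double_mult2 e iff by (intro sum.cong refl) auto
  qed
  have 2: "(flip (\<Delta> ?e) \<odot>\<odot> R) ((x, a), (y, b)) =
     (\<Sum>p\<in>UNIV. \<Sum>q\<in>UNIV. if q = g then if p = g then
        R ((- g + x + g, - g + a), (- g + y + g, - g + b)) else 0 else 0)"
    for x a y b
    unfolding double_mult2 flip_def prod.case e by (intro sum.cong refl) auto
  have "R ((x, a - g), (y, b - g)) = R ((- g + x + g, - g + a), (- g + y + g, - g + b))" for x a y b
    using eq[of x a y b] unfolding 1 2 by simp
  \<comment> \<open>The instance at which the conjugations on the right-hand side cancel.\<close>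
  from this[of "g + s - g" "g + h" "g + t - g" "g + k"] show ?thesis
    by (simp only: group_norm)
qed

lemma row_mul_apply:
  "(\<Sum>g\<in>UNIV. R ((s, h), (t, g)) * R ((s', h'), (- g + t + g, - g + k))) =
     (if h = h' then R ((s' + s, h), (t, k)) else 0)"
proof -
  have "(F (s, h) \<odot> F (s', h')) (t, k) =
      (\<Sum>m\<in>UNIV. if m = (s' + s, h) then if h = h' then R (m, (t, k)) else 0 else 0)"
    unfolding row_mul sum_fun_apply scale_def
    by (intro sum.cong refl) (auto simp: double_comult_apply delta_apply row_def)
  then show ?thesis
    by (simp add: double_mult_apply row_def)
qed

lemma comult_row_apply:
  "(\<Sum>l\<in>UNIV. R ((- l + s + l, - l + h), (t, k)) * R ((s, l), (t', k'))) =
     (if k = k' then R ((s, h), (t' + t, k)) else 0)"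
proof -
  have "\<Delta> (F (s, h)) ((t, k), (t', k')) =
      (\<Sum>i\<in>UNIV. \<Sum>j\<in>UNIV. (delta i \<odot> delta j) (s, h) * (F j (t, k) * F i (t', k')))"
    unfolding comult_row sum_fun_apply scale_def by (simp add: tensor_def)
  also have "\<dots> = (\<Sum>x\<in>UNIV. \<Sum>l\<in>UNIV. \<Sum>y\<in>UNIV. \<Sum>m\<in>UNIV. if m = - l + h then if y = - l + s + l then
      if x = s then R ((y, m), (t, k)) * R ((x, l), (t', k')) else 0 else 0 else 0)"
    unfolding sum_UNIV_prod double_mult_delta by (intro sum.cong refl) (auto simp: row_def)
  also have "\<dots> = (\<Sum>x\<in>UNIV. \<Sum>l\<in>UNIV. if x = s then
      R ((- l + s + l, - l + h), (t, k)) * R ((x, l), (t', k')) else 0)"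
    by simp
  also have "\<dots> = (\<Sum>l\<in>UNIV. R ((- l + s + l, - l + h), (t, k)) * R ((s, l), (t', k')))"
    by (rule sum_pick)
  finally show ?thesis
    by (simp add: double_comult_apply row_def)
qed

lemma row_counit_apply: "(\<Sum>k\<in>UNIV. R ((s, h), (0, k))) = (if h = 0 then 1 else 0)"
  using row_counit[of "(s, h)"] by (simp add: double_counit_apply double_one_apply row_def)

lemma antipode_invariant:
  "R ((- h - s + h, - h), (- k - t + k, - k)) = R ((s, h), (t, k))"
proof -
  have "tensor_map S id R ((s, h), (- k - t + k, - k)) = R ((- h - s + h, - h), (- k - t + k, - k))"
    by (simp add: tensor_map_id_right[OF linear_antipode] double_antipode_apply)
  moreover have "tensor_map id S R ((s, h), (- k - t + k, - k)) = R ((s, h), (t, k))"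
    unfolding tensor_map_id_left[OF linear_antipode] double_antipode_apply by (simp only: group_norm)
  ultimately show ?thesis
    by (simp add: antipode_legs)
qed

text \<open>The product \<open>F(e\<^sub>h # s) S(e\<^sub>s \<bowtie> h)\<close> keeps only the coefficients at which the second leg is compatible
  with \<open>S(e\<^sub>s \<bowtie> h)\<close>; on the support of \<open>R\<close> this compatibility is just \<open>s t = 1\<close>.\<close>

lemma drinfeld_element_apply:
  "drinfeld_element group_double R (t, k) = (\<Sum>h\<in>UNIV. R ((- t, h), (t, k + h)))"
proof -
  have iff: "- g + k = - h \<longleftrightarrow> g = k + h" for g h k :: 'g
    unfolding neg_add_eq_iff by (auto simp: group_norm simp del: add_uminus_conv_diff)
  have S: "S (delta (s, h)) = delta (- h - s + h, - h)" for s h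
    unfolding delta_pair by (simp add: group_double_def lin_ext_delta bowtie_def flip: delta_pair)
  have "(F (s, h) \<odot> S (delta (s, h))) (t, k) = (if s = - t then R ((s, h), (t, k + h)) else 0)" for s h
  proof -
    have "(F (s, h) \<odot> S (delta (s, h))) (t, k) =
       (\<Sum>g\<in>UNIV. if g = k + h then if - g + t + g = - h - s + h then R ((s, h), (t, g)) else 0 else 0)"
      unfolding double_mult_apply S by (intro sum.cong refl) (simp add: delta_apply row_def iff)
    also have "\<dots> = (if - (k + h) + t + (k + h) = - h - s + h then R ((s, h), (t, k + h)) else 0)"
      by simp
    also have "\<dots> = (if s = - t then R ((s, h), (t, k + h)) else 0)"
    proof (cases "R ((s, h), (t, k + h)) = 0")
      case False
      have neg: "- h - s + h = - (- h + s + h)"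
        by (simp only: group_norm)
      have "- (k + h) + t + (k + h) = - h - s + h \<longleftrightarrow> s = - t"
        by (simp only: neg eq_neg_iff_add_eq_0 support[OF False, symmetric])
      then show ?thesis
        by simp
    qed auto
    finally show ?thesis .
  qed
  then show ?thesis
    by (simp add: drinfeld_element_eq sum_fun_apply sum_UNIV_prod sum_pick)
qed

abbreviation uR where "uR \<equiv> drinfeld_element group_double R"

lemma drinfeld_conj: "uR (g + t - g, g + k - g) = uR (t, k)"
proof -
  have "uR (g + t - g, g + k - g) =
      (\<Sum>h\<in>UNIV. R ((- (g + t - g), g + h - g), (g + t - g, g + k - g + (g + h - g))))"
    unfolding drinfeld_element_apply
    by (rule sum.reindex_bij_witness[of _ "\<lambda>h. g + h - g" "\<lambda>h. - g + h + g"])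
       (simp_all only: group_norm UNIV_I)
  also have "\<dots> = (\<Sum>h\<in>UNIV. R ((g + - t - g, g + h - g), (g + t - g, g + (k + h) - g)))"
    by (simp only: group_norm)
  finally show ?thesis
    by (simp only: conj_invariant drinfeld_element_apply)
qed

lemma drinfeld_support:
  assumes "uR (t, k) \<noteq> 0"
  shows "t + k = k + t"
proof -
  from assms obtain h where "R ((- t, h), (t, k + h)) \<noteq> 0"
    unfolding drinfeld_element_apply by (rule sum.not_neutral_contains_not_neutral)
  note supp = support[OF this]
  have "t + k = k + (h + ((- (k + h) + t + (k + h) + (- h + - t + h)) + (- h + t)))"
    by (simp only: group_norm)
  also have "\<dots> = k + t"
    unfolding supp[symmetric] by (simp only: group_norm)
  finally show ?thesis .
qed

text \<open>Multiplying by an element supported on commuting pairs involves no conjugation on one side, and on the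
  other side conjugation invariance removes it.\<close>

lemma drinfeld_central: "uR \<odot> x = x \<odot> uR"
proof -
  have "(uR \<odot> x) (s, h) = (x \<odot> uR) (s, h)" for s h
  proof -
    have "(uR \<odot> x) (s, h) = (\<Sum>g\<in>UNIV. uR (s, g) * x (s, - g + h))"
      unfolding double_mult_apply
    proof (intro sum.cong refl)
      fix g
      have "- g + s + g = s" if "uR (s, g) \<noteq> 0"
        unfolding add.assoc drinfeld_support[OF that] by (rule minus_add_cancel)
      then show "uR (s, g) * x (- g + s + g, - g + h) = uR (s, g) * x (s, - g + h)"
        by (cases "uR (s, g) = 0") auto
    qed
    also have "\<dots> = (\<Sum>g\<in>UNIV. uR (s, h - g) * x (s, g))"
      by (rule sum.reindex_bij_witness[of _ "\<lambda>g. h - g" "\<lambda>g. - g + h"])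
         (simp_all add: group_norm del: add_uminus_conv_diff)
    also have "\<dots> = (\<Sum>g\<in>UNIV. x (s, g) * uR (- g + s + g, - g + h))"
    proof (intro sum.cong refl)
      fix g
      show "uR (s, h - g) * x (s, g) = x (s, g) * uR (- g + s + g, - g + h)"
        using drinfeld_conj[of g "- g + s + g" "- g + h"]
        by (simp add: group_norm mult.commute del: add_uminus_conv_diff)
    qed
    finally show ?thesis
      by (simp add: double_mult_apply)
  qed
  then show ?thesis by auto
qed

text \<open>On commuting pairs \<open>S\<close> inverts both entries. The invariance of \<open>R\<close> under \<open>S \<otimes> S\<close> followed by
  conjugation by the summation variable matches the two sums term by term.\<close>

lemma drinfeld_antipode: "S uR = uR"
proof -
  have neg: "uR (- s, - h) = uR (s, h)" if comm: "s + h = h + s" for s h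
  proof -
    have "uR (- s, - h) = (\<Sum>l\<in>UNIV. R ((s, l), (- s, - h + l)))"
      by (simp add: drinfeld_element_apply)
    also have "\<dots> = (\<Sum>l\<in>UNIV. R ((- s, - l), (s, h - l)))"
    proof (intro sum.cong refl)
      fix l
      have "R ((s, l), (- s, - h + l)) = R ((- l - s + l, - l), (- (- h + l) + s + (- h + l), - (- h + l)))"
        using antipode_invariant[of l s "- h + l" "- s"] by simp
      \<comment> \<open>Conjugation by the summation variable \<open>l\<close> restores \<open>- s\<close> in the first leg.\<close>
      also have "\<dots> = R ((l + (- l - s + l) - l, l + - l - l), (l + (- (- h + l) + s + (- h + l)) - l,
          l + - (- h + l) - l))"
        by (rule conj_invariant[symmetric])
      also have "\<dots> = R ((- s, - l), (h + s - h, h - l))"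
        by (simp only: group_norm)
      finally show "R ((s, l), (- s, - h + l)) = R ((- s, - l), (s, h - l))"
        by (simp only: comm[symmetric] add_diff_cancel)
    qed
    also have "\<dots> = (\<Sum>l\<in>UNIV. R ((- s, l), (s, h + l)))"
      by (rule sum.reindex_bij_witness[of _ uminus uminus]) auto
    finally show ?thesis
      by (simp add: drinfeld_element_apply)
  qed
  have "S uR (s, h) = uR (s, h)" for s h
  proof -
    have "S uR (s, h) = uR (h + (- h - s + h) - h, h + - h - h)"
      by (simp only: drinfeld_conj double_antipode_apply)
    also have "\<dots> = uR (- s, - h)"
      by (simp only: group_norm)
    also have "\<dots> = uR (s, h)"
    proof (cases "s + h = h + s")
      case False
      then have "- s + - h \<noteq> - h + - s"
        by (metis minus_add minus_minus)
      with False show ?thesis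
        using drinfeld_support by metis
    qed (rule neg)
    finally show ?thesis .
  qed
  then show ?thesis by auto
qed

lemma drinfeld_counit: "hcounit group_double uR = 1"
proof -
  have "hcounit group_double uR = (\<Sum>h\<in>UNIV. \<Sum>g\<in>UNIV. R ((0, h), (0, g + h)))"
    by (simp add: double_counit_apply drinfeld_element_apply) (rule sum.swap)
  also have "\<dots> = (\<Sum>h\<in>UNIV. \<Sum>g\<in>UNIV. R ((0, h), (0, g)))"
  proof (rule sum.cong[OF refl])
    show "(\<Sum>g\<in>UNIV. R ((0, h), (0, g + h))) = (\<Sum>g\<in>UNIV. R ((0, h), (0, g)))" for h
      by (rule sum.reindex_bij_witness[of _ "\<lambda>g. g - h" "\<lambda>g. g + h"]) simp_all
  qed
  finally show ?thesis
    by (simp add: row_counit_apply)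
qed

end


section \<open>The Drinfel'd element in terms of the components\<close>

lemma grp_mult_apply: "(x \<cdot> y) k = (\<Sum>g\<in>UNIV. x g * y (- g + k))"
  by (simp add: grp_mult_def bilin_ext_apply delta_mult if_distrib[of "\<lambda>c. _ * c"] cong: if_cong)

lemma grp_mult_delta_apply: "(x \<cdot> delta g) k = x (k - g)"
proof -
  have iff: "- h + k = g \<longleftrightarrow> h = k - g" for h
    unfolding neg_add_eq_iff by (auto simp: group_norm simp del: add_uminus_conv_diff)
  show ?thesis
    by (simp add: grp_mult_apply delta_apply iff if_distrib[of "\<lambda>c. _ * c"] cong: if_cong)
qed

lemma proj_fun_apply: "proj_fun X t = (\<Sum>k\<in>UNIV. X (t, k))"
proof -
  have "proj_fun X t = (\<Sum>s\<in>UNIV. \<Sum>k\<in>UNIV. if s = t then X (s, k) else 0)"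
    unfolding proj_fun_def contract_right_def lin_ext_apply sum_UNIV_prod
    by (intro sum.cong refl) (simp add: scale_def delta_apply)
  then show ?thesis
    by (simp add: sum_pick)
qed

lemma proj_grp_apply: "proj_grp X k = X (0, k)"
proof -
  have "proj_grp X k = (\<Sum>s\<in>UNIV. \<Sum>h\<in>UNIV. if s = 0 then if h = k then X (s, h) else 0 else 0)"
    unfolding proj_grp_def contract_left_def lin_ext_apply sum_UNIV_prod
    by (intro sum.cong refl) (simp add: scale_def delta_apply)
  then show ?thesis
    by (simp add: sum_pick)
qed

lemma Fmap_dual_elem_apply:
  fixes R :: "('g::{finite,group_add}, 'k::field) double2"
  shows "Fmap R (dual_elem f s) q = (\<Sum>h\<in>UNIV. f h * R ((s, h), q))"
proof -
  have dual: "dual_elem f s (delta (x, h)) = (if x = s then f h else 0)" for x h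
  proof -
    have "dual_elem f s (delta (x, h)) =
        (\<Sum>y\<in>UNIV. \<Sum>k\<in>UNIV. if y = x then if k = h then if x = s then f h else 0 else 0 else 0)"
      unfolding dual_elem_def sum_UNIV_prod by (intro sum.cong refl) (simp add: delta_apply)
    then show ?thesis
      by (simp add: sum_pick)
  qed
  have "Fmap R \<phi> q = (\<Sum>p\<in>UNIV. \<phi> (delta p) * R (p, q))" for \<phi> :: "('g \<times> 'g \<Rightarrow> 'k) \<Rightarrow> 'k"
    unfolding Fmap_def contract_left_def lin_ext_apply
    by (subst sum_UNIV_prod)
       (simp add: scale_def delta_apply if_distrib[of "\<lambda>c. _ * c"] mult.commute cong: if_cong)
  then have "Fmap R (dual_elem f s) q =
      (\<Sum>x\<in>UNIV. \<Sum>h\<in>UNIV. if x = s then f h * R ((x, h), q) else 0)"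
    by (simp add: sum_UNIV_prod dual if_distrib[of "\<lambda>c. c * _"] cong: if_cong)
  then show ?thesis
    by (simp add: sum_pick)
qed

lemma comp_apply:
  fixes R :: "('g::{finite,group_add}, 'k::field) double2"
  shows comp_u_apply: "comp_u R (delta h) t = (\<Sum>k\<in>UNIV. R ((0, h), (t, k)))"
    and comp_p_apply: "comp_p R (delta h) k = R ((0, h), (0, k))"
    and comp_r_apply: "comp_r R (delta s) t = (\<Sum>h\<in>UNIV. \<Sum>k\<in>UNIV. R ((s, h), (t, k)))"
    and comp_v_apply: "comp_v R (delta s) k = (\<Sum>h\<in>UNIV. R ((s, h), (0, k)))"
proof -
  have pick: "(\<Sum>x\<in>UNIV. delta h x * f x) = f h" for h and f :: "'g \<Rightarrow> 'k"
    by (simp add: delta_apply if_distrib[of "\<lambda>c. c * _"] cong: if_cong)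
  show "comp_u R (delta h) t = (\<Sum>k\<in>UNIV. R ((0, h), (t, k)))"
    "comp_p R (delta h) k = R ((0, h), (0, k))"
    "comp_v R (delta s) k = (\<Sum>h\<in>UNIV. R ((s, h), (0, k)))"
    by (simp_all add: comp_u_def comp_p_def comp_v_def lin_ext_delta proj_fun_apply proj_grp_apply
        Fmap_dual_elem_apply pick)
  show "comp_r R (delta s) t = (\<Sum>h\<in>UNIV. \<Sum>k\<in>UNIV. R ((s, h), (t, k)))"
    by (simp add: comp_r_def lin_ext_delta proj_fun_apply Fmap_dual_elem_apply) (rule sum.swap)
qed

context quasitriangular_double
begin

abbreviation U where "U h \<equiv> comp_u R (delta h)"
abbreviation r where "r s \<equiv> comp_r R (delta s)"
abbreviation P where "P h \<equiv> comp_p R (delta h)"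
abbreviation v where "v s \<equiv> comp_v R (delta s)"

text \<open>The support condition at \<open>s = 1\<close>, where it says that all \<open>e\<^sub>y\<close> commute with \<open>F(e\<^sub>h # 1)\<close>.\<close>

lemma support_zero:
  assumes "R ((0, h), (t, k)) \<noteq> 0"
  shows "k + t = t + k"
proof -
  have "t = - k + t + k"
    using support[OF assms] by simp
  then have "k + t = k + (- k + t + k)"
    by (rule arg_cong)
  then show ?thesis
    by (simp only: group_norm)
qed

text \<open>For every \<open>t\<close> the coproduct formula writes \<open>p(e\<^sub>h)\<close> as a sum of products, one factor of which is a
  coefficient at \<open>e\<^sub>t \<bowtie> k\<close>. All these coefficients vanish unless \<open>k\<close> commutes with \<open>t\<close>.\<close>

lemma p_central_right:
  assumes "P h k \<noteq> 0"
  shows "k + t = t + k"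
proof -
  have "(\<Sum>l\<in>UNIV. R ((0, - l + h), (- t, k)) * R ((0, l), (t, k))) = P h k"
    \<comment> \<open>The arguments \<open>- t\<close> and \<open>t\<close> add up to \<open>0\<close>, the place where \<open>p\<close> is read off.\<close>
    using comult_row_apply[of 0 h "- t" k t k] by (simp add: comp_p_apply)
  with assms have "(\<Sum>l\<in>UNIV. R ((0, - l + h), (- t, k)) * R ((0, l), (t, k))) \<noteq> 0"
    by simp
  then obtain l where "R ((0, - l + h), (- t, k)) * R ((0, l), (t, k)) \<noteq> 0"
    by (rule sum.not_neutral_contains_not_neutral)
  then show ?thesis
    using support_zero[of l t k] by simp
qed

text \<open>Since \<open>p\<close> is compatible with conjugation and has central values, \<open>p(e\<^sub>h)\<close> depends only on
  the conjugacy class of \<open>h\<close>. But the \<open>p(e\<^sub>h)\<close> are orthogonal idempotents, so that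
  \<open>p(e\<^sub>h)\<close> vanishes if \<open>h\<close> has a conjugate other than itself.\<close>

lemma p_central_left:
  assumes "P h k \<noteq> 0"
  shows "h + g = g + h"
proof (rule ccontr)
  assume not_central: "h + g \<noteq> g + h"
  have conj: "P (g + h - g) m = P h m" for m
  proof (cases "P h m = 0 \<and> P (g + h - g) m = 0")
    case False
    then have "m + g = g + m"
      using p_central_right by blast
    then have "g + m - g = m"
      by (metis add_diff_cancel)
    then show ?thesis
      using conj_invariant[of g 0 h 0 m] by (simp add: comp_p_apply)
  qed simp
  have "g + h - g \<noteq> h"
    using not_central by (metis diff_add_cancel)
  have "P h k = (\<Sum>m\<in>UNIV. P h m * P h (- m + k))"
    using row_mul_apply[of 0 h 0 0 h k] by (simp add: comp_p_apply)
  also have "\<dots> = (\<Sum>m\<in>UNIV. P h m * P (g + h - g) (- m + k))"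
    by (simp only: conj)
  also have "\<dots> = 0"
    using row_mul_apply[of 0 h 0 0 "g + h - g" k] \<open>g + h - g \<noteq> h\<close> by (simp add: comp_p_apply)
  finally show False
    using assms by simp
qed

text \<open>\<open>F(e\<^sub>h # 1)\<close> is recovered from its coproduct by projecting the two legs to their components.\<close>

lemma row_zero_eq: "R ((0, h), (t, k)) = (\<Sum>l\<in>UNIV. P (- l + h) k * U l t)"
proof -
  have "(\<Sum>l\<in>UNIV. P (- l + h) k * U l t) =
      (\<Sum>l\<in>UNIV. \<Sum>k'\<in>UNIV. R ((0, - l + h), (0, k)) * R ((0, l), (t, k')))"
    by (simp add: comp_p_apply comp_u_apply sum_distrib_left)
  also have "\<dots> = (\<Sum>k'\<in>UNIV. \<Sum>l\<in>UNIV. R ((0, - l + h), (0, k)) * R ((0, l), (t, k')))"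
    by (rule sum.swap)
  also have "\<dots> = (\<Sum>k'\<in>UNIV. if k = k' then R ((0, h), (t, k)) else 0)"
    using comult_row_apply[of 0 h 0 k t] by simp
  finally show ?thesis
    by simp
qed

text \<open>The map \<open>u\<close> commutes with the antipodes, by the invariance of \<open>R\<close> under \<open>S \<otimes> S\<close>.\<close>

lemma u_uminus: "U (- l) (- t) = U l t"
proof -
  have "R ((0, - l), (- t, - k)) = R ((0, l), (t, k))" for k
  proof (cases "k + t = t + k")
    case True
    have "- k - t + k = - (t + k) + k"
      by (simp only: group_norm)
    also have "\<dots> = - t"
      by (simp only: True[symmetric]) (simp only: group_norm)
    finally show ?thesis
      using antipode_invariant[of l 0 k t] by simp
  next
    case False
    then have "- k + - t \<noteq> - t + - k"
      by (metis minus_add minus_minus)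
    with False show ?thesis
      using support_zero by metis
  qed
  then have "(\<Sum>k\<in>UNIV. R ((0, - l), (- t, - k))) = U l t"
    by (simp add: comp_u_apply)
  moreover have "(\<Sum>k\<in>UNIV. R ((0, - l), (- t, - k))) = U (- l) (- t)"
    unfolding comp_u_apply by (rule sum.reindex_bij_witness[of _ uminus uminus]) auto
  ultimately show ?thesis
    by simp
qed

text \<open>This is \<open>F(\<epsilon> # s) = r(s) \<bowtie> v(s)\<close>. Projecting the coproduct to components gives
  \<open>\<Sum>l. r(l\<^sup>-\<^sup>1 s l)\<close> times the group component of \<open>F(e\<^sub>l # s)\<close>. That component is a multiple of
  \<open>p(e\<^sub>l)\<close>, so that only central \<open>l\<close> contribute.\<close>

lemma sum_rows_eq: "(\<Sum>h\<in>UNIV. R ((s, h), (t, k))) = r s t * v s k"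
proof -
  have central: "- l + s + l = s" if "R ((s, l), (0, k)) \<noteq> 0" for l
  proof -
    have "(\<Sum>g\<in>UNIV. P l g * R ((s, l), (0, - g + k))) = R ((s, l), (0, k))"
      using row_mul_apply[of 0 l 0 s l k] by (simp add: comp_p_apply)
    with that have "(\<Sum>g\<in>UNIV. P l g * R ((s, l), (0, - g + k))) \<noteq> 0"
      by simp
    then obtain g where "P l g * R ((s, l), (0, - g + k)) \<noteq> 0"
      by (rule sum.not_neutral_contains_not_neutral)
    then have "l + s = s + l"
      using p_central_left[of l g s] by simp
    then show ?thesis
      by (simp only: add.assoc minus_add_cancel flip: \<open>l + s = s + l\<close>)
  qed
  have "(\<Sum>h\<in>UNIV. R ((s, h), (t, k))) = (\<Sum>h\<in>UNIV. \<Sum>k'\<in>UNIV. if k' = k then R ((s, h), (t, k')) else 0)"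
    by simp
  also have "\<dots> = (\<Sum>h\<in>UNIV. \<Sum>k'\<in>UNIV. \<Sum>l\<in>UNIV. R ((- l + s + l, - l + h), (t, k')) * R ((s, l), (0, k)))"
    using comult_row_apply[of s _ t _ 0 k] by simp
  also have "\<dots> = (\<Sum>h\<in>UNIV. \<Sum>l\<in>UNIV. \<Sum>k'\<in>UNIV. R ((- l + s + l, - l + h), (t, k')) * R ((s, l), (0, k)))"
    by (intro sum.cong[OF refl] sum.swap)
  also have "\<dots> = (\<Sum>l\<in>UNIV. \<Sum>h\<in>UNIV. \<Sum>k'\<in>UNIV. R ((- l + s + l, - l + h), (t, k')) * R ((s, l), (0, k)))"
    by (rule sum.swap)
  also have "\<dots> = (\<Sum>l\<in>UNIV. r s t * R ((s, l), (0, k)))"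
  proof (rule sum.cong[OF refl])
    fix l
    show "(\<Sum>h\<in>UNIV. \<Sum>k'\<in>UNIV. R ((- l + s + l, - l + h), (t, k')) * R ((s, l), (0, k))) =
        r s t * R ((s, l), (0, k))"
    proof (cases "R ((s, l), (0, k)) = 0")
      case False
      have "(\<Sum>h\<in>UNIV. \<Sum>k'\<in>UNIV. R ((s, - l + h), (t, k'))) = r s t"
        using sum_shift[of "\<lambda>h. \<Sum>k'\<in>UNIV. R ((s, h), (t, k'))" "- l"] by (simp add: comp_r_apply)
      then show ?thesis
        by (simp add: central[OF False] sum_distrib_right[symmetric])
    qed simp
  qed
  finally show ?thesis
    by (simp add: comp_v_apply sum_distrib_left)
qed

text \<open>The factorisation \<open>F(e\<^sub>h # s) = F(e\<^sub>h # 1) F(\<epsilon> # s)\<close>. The product in the double conjugates \<open>r(s)\<close> by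
  elements that commute with \<open>t\<close>, by \<open>support_zero\<close>.\<close>

lemma row_eq: "R ((s, h), (t, k)) = r s t * (\<Sum>g\<in>UNIV. R ((0, h), (t, g)) * v s (- g + k))"
proof -
  have "R ((s, h), (t, k)) = (\<Sum>h'\<in>UNIV. if h = h' then R ((s + 0, h), (t, k)) else 0)"
    by simp
  also have "\<dots> = (\<Sum>h'\<in>UNIV. \<Sum>g\<in>UNIV. R ((0, h), (t, g)) * R ((s, h'), (- g + t + g, - g + k)))"
    by (simp only: row_mul_apply)
  also have "\<dots> = (\<Sum>g\<in>UNIV. \<Sum>h'\<in>UNIV. R ((0, h), (t, g)) * R ((s, h'), (- g + t + g, - g + k)))"
    by (rule sum.swap)
  also have "\<dots> = (\<Sum>g\<in>UNIV. r s t * (R ((0, h), (t, g)) * v s (- g + k)))"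
  proof (rule sum.cong[OF refl])
    fix g
    show "(\<Sum>h'\<in>UNIV. R ((0, h), (t, g)) * R ((s, h'), (- g + t + g, - g + k))) =
        r s t * (R ((0, h), (t, g)) * v s (- g + k))"
    proof (cases "R ((0, h), (t, g)) = 0")
      case False
      have "- g + t + g = t"
        unfolding add.assoc support_zero[OF False, symmetric] by (rule minus_add_cancel)
      then show ?thesis
        by (simp add: sum_distrib_left[symmetric] sum_rows_eq)
    qed simp
  qed
  finally show ?thesis
    by (simp only: sum_distrib_left)
qed

text \<open>The index \<open>h\<close> of the single sum for the Drinfel'd element splits as \<open>h = l a\<close>, where \<open>l\<close> belongs to
  \<open>u\<close> and \<open>a\<close> to \<open>p\<close>; centrality of \<open>a\<close> puts it in front.\<close>

lemma drinfeld_coeff: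
  "uR (t, k) = r (- t) t * (\<Sum>a\<in>UNIV. \<Sum>l\<in>UNIV. \<Sum>g\<in>UNIV. P a g * U l t * v (- t) (a - g + k + l))"
proof -
  have "uR (t, k) = r (- t) t * (\<Sum>h\<in>UNIV. \<Sum>g\<in>UNIV. \<Sum>l\<in>UNIV. P (- l + h) g * U l t * v (- t) (- g + (k + h)))"
    unfolding drinfeld_element_apply row_eq[of "- t"]
    by (simp only: row_zero_eq sum_distrib_left sum_distrib_right)
  also have "(\<Sum>h\<in>UNIV. \<Sum>g\<in>UNIV. \<Sum>l\<in>UNIV. P (- l + h) g * U l t * v (- t) (- g + (k + h))) =
     (\<Sum>h\<in>UNIV. \<Sum>l\<in>UNIV. \<Sum>g\<in>UNIV. P (- l + h) g * U l t * v (- t) (- g + (k + h)))"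
    by (intro sum.cong[OF refl] sum.swap)
  also have "\<dots> = (\<Sum>l\<in>UNIV. \<Sum>h\<in>UNIV. \<Sum>g\<in>UNIV. P (- l + h) g * U l t * v (- t) (- g + (k + h)))"
    by (rule sum.swap)
  also have "\<dots> = (\<Sum>l\<in>UNIV. \<Sum>a\<in>UNIV. \<Sum>g\<in>UNIV. P a g * U l t * v (- t) (a - g + k + l))"
  proof (rule sum.cong[OF refl])
    fix l
    have "(\<Sum>h\<in>UNIV. \<Sum>g\<in>UNIV. P (- l + h) g * U l t * v (- t) (- g + (k + h))) =
        (\<Sum>a\<in>UNIV. \<Sum>g\<in>UNIV. P a g * U l t * v (- t) (- g + (k + (l + a))))"
      by (subst sum_shift[of _ l]) (simp only: minus_add_cancel)
    also have "\<dots> = (\<Sum>a\<in>UNIV. \<Sum>g\<in>UNIV. P a g * U l t * v (- t) (a - g + k + l))"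
    proof (intro sum.cong[OF refl])
      fix a g
      show "P a g * U l t * v (- t) (- g + (k + (l + a))) = P a g * U l t * v (- t) (a - g + k + l)"
      proof (cases "P a g = 0")
        case False
        have "a - g + k + l = a + (- g + k + l)"
          by (simp only: group_norm)
        also have "\<dots> = - g + (k + (l + a))"
          unfolding p_central_left[OF False] by (simp only: group_norm)
        finally show ?thesis
          by simp
      qed simp
    qed
    finally show "(\<Sum>h\<in>UNIV. \<Sum>g\<in>UNIV. P (- l + h) g * U l t * v (- t) (- g + (k + h))) = \<dots>" .
  qed
  also have "\<dots> = (\<Sum>a\<in>UNIV. \<Sum>l\<in>UNIV. \<Sum>g\<in>UNIV. P a g * U l t * v (- t) (a - g + k + l))"
    by (rule sum.swap)
  finally show ?thesis .
qed

text \<open>In \<open>u\<^sup>*(t\<^sup>-\<^sup>1)\<close> the coefficient of \<open>l\<^sup>-\<^sup>1\<close> is \<open>u(e\<^sub>l)(t)\<close>, by \<open>u_uminus\<close>.\<close>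

lemma formula_coeff:
  "(P a \<cdot> delta (- a) \<cdot> v (- t) \<cdot> transpose_map (comp_u R) (delta (- t))) k =
     (\<Sum>l\<in>UNIV. \<Sum>g\<in>UNIV. P a g * U l t * v (- t) (a - g + k + l))"
proof -
  have transpose: "transpose_map (comp_u R) (delta (- t)) l = U (- l) t" for l
    using u_uminus[of "- l" t]
    by (simp add: transpose_map_def delta_apply if_distrib[of "\<lambda>c. c * _"] cong: if_cong)
  have left: "(P a \<cdot> delta (- a) \<cdot> v (- t)) x = (\<Sum>g\<in>UNIV. P a g * v (- t) (a - g + x))" for x
  proof -
    have "(P a \<cdot> delta (- a) \<cdot> v (- t)) x = (\<Sum>g\<in>UNIV. P a (g + a) * v (- t) (- g + x))"
      unfolding grp_mult_apply[of _ "v (- t)"] by (simp add: grp_mult_delta_apply)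
    also have "\<dots> = (\<Sum>g\<in>UNIV. P a g * v (- t) (a - g + x))"
      by (rule sum.reindex_bij_witness[of _ "\<lambda>g. g - a" "\<lambda>g. g + a"]) (simp_all only: group_norm UNIV_I)
    finally show ?thesis .
  qed
  have "(P a \<cdot> delta (- a) \<cdot> v (- t) \<cdot> transpose_map (comp_u R) (delta (- t))) k =
      (\<Sum>x\<in>UNIV. \<Sum>g\<in>UNIV. P a g * v (- t) (a - g + x) * U (- (- x + k)) t)"
    by (simp only: grp_mult_apply[of _ "transpose_map _ _"] left transpose sum_distrib_right)
  also have "\<dots> = (\<Sum>l\<in>UNIV. \<Sum>g\<in>UNIV. P a g * v (- t) (a - g + (k + l)) * U (- (- (k + l) + k)) t)"
    by (rule sum_shift)
  finally show ?thesis
    by (simp only: group_norm mult_ac)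
qed

theorem drinfeld_formula:
  "uR = (\<Sum>a\<in>UNIV. \<Sum>s\<in>UNIV. (r s * delta (- s)) \<bowtie>
          (P a \<cdot> delta (- a) \<cdot> v s \<cdot> transpose_map (comp_u R) (delta s)))"
proof -
  have "(\<Sum>a\<in>UNIV. \<Sum>s\<in>UNIV. (r s * delta (- s)) \<bowtie>
      (P a \<cdot> delta (- a) \<cdot> v s \<cdot> transpose_map (comp_u R) (delta s))) (t, k) = uR (t, k)" for t k
  proof -
    have "(\<Sum>a\<in>UNIV. \<Sum>s\<in>UNIV. (r s * delta (- s)) \<bowtie>
        (P a \<cdot> delta (- a) \<cdot> v s \<cdot> transpose_map (comp_u R) (delta s))) (t, k) =
      (\<Sum>a\<in>UNIV. \<Sum>s\<in>UNIV. if s = - t then r s t *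
          (P a \<cdot> delta (- a) \<cdot> v s \<cdot> transpose_map (comp_u R) (delta s)) k else 0)"
      unfolding sum_fun_apply
      by (intro sum.cong[OF refl]) (auto simp: bowtie_def tensor_def delta_apply)
    also have "\<dots> = r (- t) t * (\<Sum>a\<in>UNIV. (P a \<cdot> delta (- a) \<cdot> v (- t) \<cdot>
        transpose_map (comp_u R) (delta (- t))) k)"
      by (simp add: sum_distrib_left)
    finally show ?thesis
      by (simp only: formula_coeff drinfeld_coeff)
  qed
  then show ?thesis
    by auto
qed

end

theorem theorem6p1:
  fixes R :: "('g::{finite,group_add}, 'k::field) double2"
  assumes "quasitriangular group_double R"
  shows "drinfeld_element group_double R =
           (\<Sum>a\<in>UNIV. \<Sum>s\<in>UNIV.
              (comp_r R (delta s) * delta (- s)) \<bowtie>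
              (comp_p R (delta a) \<cdot> delta (- a) \<cdot> comp_v R (delta s) \<cdot>
                transpose_map (comp_u R) (delta s))) \<and>
         ribbon_element group_double R (drinfeld_element group_double R)"
proof -
  interpret quasitriangular_double R
    by unfold_locales (rule assms)
  show ?thesis
    using drinfeld_formula
      ribbon_drinfeld_element[OF drinfeld_central drinfeld_antipode drinfeld_counit] ..
qed

end
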